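(* Let $G$ be a fixed graph with $\mathsf{mtd}(G) = d$. Then, given an $m$-edge graph $H$ as input, the number of homomorphisms from $G$ to $H$ can be computed in $\widetilde{O}(m^{\lceil d/2 \rceil})$ time and constant space.
   Context: All graphs are simple. A homomorphism from $G$ to $H$ is a map $\phi: V(G)\to V(H)$ such that $uv\in E(G)$ implies $\phi(u)\phi(v)\in E(H)$. Pattern graphs are assumed connected. An elimination tree of a connected graph $G$ is a rooted tree $(T,r)$ with $r\in V(G)$ whose root-subtrees are, recursively, elimination trees of the connected components of $G - r$ (the elimination tree of the empty graph is empty); its depth is the maximum number of vertices on a root-to-leaf path. A matched elimination tree is an elimination tree such that for every root-to-leaf path $(v_1,\dots,v_k)$: if $k$ is even, $v_1v_2, v_3v_4,\dots,v_{k-1}v_k$ are all edges of $G$; if $k$ is odd, the sequence can be split into consecutive blocks, all of size 2 except exactly one block of size 3, such that each block $(v_j,v_{j+1})$ of size 2 satisfies $v_jv_{j+1}\in E(G)$ and the block $(v_j,v_{j+1},v_{j+2})$ of size 3 satisfies $v_jv_{j+1},v_{j+1}v_{j+2}\in E(G)$. The matched treedepth $\mathsf{mtd}(G)$ is the minimum depth of a matched elimination tree of $G$. Computational model: unit-cost RAM (a vertex label fits in one word); the host graph is given by a representation allowing adjacency queries in $\widetilde{O}(1)$ time and iteration over all edges $xy$ ordered by $x$ in $\widetilde{O}(m)$ time. $\widetilde{O}$ hides factors polylogarithmic in the input size; the pattern $G$ is fixed (constant size), and constant space means $O(1)$ words. *)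

theory Defs
  imports
    Complex_Main
    "HOL-Library.Extended_Nat"
    "HOL-Library.FuncSet"
    "Graph_Theory.Digraph_Component"
begin

section \<open>Simple graphs and homomorphisms\<close>

text \<open>
  A finite simple graph is a \<open>pair_graph\<close>: a finite, loop-free, symmetric arc relation, so an edge
  \<open>uv\<close> is present as both arcs \<open>(u, v)\<close> and \<open>(v, u)\<close>.
\<close>

definition num_edges :: "'a pair_pre_digraph \<Rightarrow> nat" where
  "num_edges G = card ((\<lambda>(u, v). {u, v}) ` parcs G)"

definition homs :: "'a pair_pre_digraph \<Rightarrow> 'b pair_pre_digraph \<Rightarrow> ('a \<Rightarrow> 'b) set" where
  "homs G H = {\<phi> \<in> pverts G \<rightarrow>\<^sub>E pverts H. \<forall>u v. (u, v) \<in> parcs G \<longrightarrow> (\<phi> u, \<phi> v) \<in> parcs H}"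

definition induced :: "'a pair_pre_digraph \<Rightarrow> 'a set \<Rightarrow> 'a pair_pre_digraph" where
  "induced G S = \<lparr>pverts = S, parcs = parcs G \<inter> S \<times> S\<rparr>"

definition remove_vertex :: "'a pair_pre_digraph \<Rightarrow> 'a \<Rightarrow> 'a pair_pre_digraph" where
  "remove_vertex G r = induced G (pverts G - {r})"

definition components :: "'a pair_pre_digraph \<Rightarrow> 'a pair_pre_digraph set" where
  "components G = {induced G {v. u \<rightarrow>\<^sup>*\<^bsub>with_proj G\<^esub> v} | u. u \<in> pverts G}"

section \<open>Matched treedepth\<close>

datatype 'a rtree = Node 'a "'a rtree list"

inductive elim_tree :: "'a pair_pre_digraph \<Rightarrow> 'a rtree \<Rightarrow> bool" where
  "r \<in> pverts G \<Longrightarrow> distinct Cs \<Longrightarrow> set Cs = components (remove_vertex G r) \<Longrightarrow>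
   list_all2 elim_tree Cs ts \<Longrightarrow> elim_tree G (Node r ts)"
monos list_all2_mono

fun root_leaf_paths :: "'a rtree \<Rightarrow> 'a list set" where
  "root_leaf_paths (Node r ts) =
     (if ts = [] then {[r]} else (#) r ` (\<Union>t\<in>set ts. root_leaf_paths t))"

definition depth :: "'a rtree \<Rightarrow> nat" where
  "depth t = Max (length ` root_leaf_paths t)"

definition matched_path :: "'a pair_pre_digraph \<Rightarrow> 'a list \<Rightarrow> bool" where
  "matched_path G p \<longleftrightarrow>
     (if even (length p)
      then \<forall>i. even i \<and> Suc i < length p \<longrightarrow> (p ! i, p ! Suc i) \<in> parcs G
      else \<exists>bs. concat bs = p
             \<and> (\<forall>b\<in>set bs. length b = 2 \<or> length b = 3)
             \<and> length (filter (\<lambda>b. length b = 3) bs) = 1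
             \<and> (\<forall>b\<in>set bs. \<forall>i. Suc i < length b \<longrightarrow> (b ! i, b ! Suc i) \<in> parcs G))"

definition matched_elim_tree :: "'a pair_pre_digraph \<Rightarrow> 'a rtree \<Rightarrow> bool" where
  "matched_elim_tree G t \<longleftrightarrow> elim_tree G t \<and> (\<forall>p\<in>root_leaf_paths t. matched_path G p)"

text \<open>
  The value is \<open>\<infinity>\<close> if there is no matched elimination tree. Among connected graphs this concerns
  only the one-vertex graph, whose single root-to-leaf path has one vertex and hence no block of
  size 3.
\<close>

definition mtd :: "'a pair_pre_digraph \<Rightarrow> enat" where
  "mtd G = Inf {enat (depth t) | t. matched_elim_tree G t}"

section \<open>Representations of the host graph\<close>

text \<open>
  The machine sees the host graph only through adjacency queries and through iterators running over
  \<open>edge_seq\<close>. Costs are part of the representation: \<open>adj_cost x y\<close> is the cost of querying \<open>xy\<close>,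
  \<open>reset_cost\<close> that of starting an iteration, and \<open>next_cost i\<close> that of advancing an iterator
  standing at position \<open>i\<close> (where \<open>i = length edge_seq\<close> is the detection of the end).
\<close>

record host_rep =
  host :: "nat pair_pre_digraph"
  edge_seq :: "(nat \<times> nat) list"
  adj_cost :: "nat \<Rightarrow> nat \<Rightarrow> nat"
  reset_cost :: nat
  next_cost :: "nat \<Rightarrow> nat"

definition input_size :: "'a pair_pre_digraph \<Rightarrow> nat" where
  "input_size H = card (pverts H) + num_edges H"

text \<open>
  \<open>soft_bound c k e H\<close> is the explicit form of soft-O of \<open>m\<^sup>e\<close>: constant \<open>c\<close>, hidden factor
  \<open>log\<^sup>k\<close> of the input size. The shift by 2 makes the logarithm at least 1, and the maximum keeps
  the bound positive for edgeless graphs.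
\<close>

definition soft_bound :: "real \<Rightarrow> nat \<Rightarrow> nat \<Rightarrow> 'a pair_pre_digraph \<Rightarrow> real" where
  "soft_bound c k e H =
     c * real (max 1 (num_edges H)) ^ e * log 2 (real (input_size H + 2)) ^ k"

text \<open>
  \<open>w\<close> is the word length in bits. The iteration lists every edge in both orientations, so that
  being ordered by the first component groups all neighbours of a vertex together. The cost
  condition on iteration is amortised over one full pass.
\<close>

definition valid_rep :: "real \<Rightarrow> nat \<Rightarrow> nat \<Rightarrow> host_rep \<Rightarrow> bool" where
  "valid_rep c k w R \<longleftrightarrow>
     pair_graph (host R)
     \<and> 0 < w \<and> (\<forall>x\<in>pverts (host R). x < 2 ^ w)
     \<and> set (edge_seq R) = parcs (host R) \<and> distinct (edge_seq R) \<and> sorted (map fst (edge_seq R))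
     \<and> (\<forall>x\<in>pverts (host R). \<forall>y\<in>pverts (host R). real (adj_cost R x y) \<le> soft_bound c k 0 (host R))
     \<and> real (reset_cost R + (\<Sum>i\<le>length (edge_seq R). next_cost R i)) \<le> soft_bound c k 1 (host R)"

section \<open>Unit-cost RAM\<close>

text \<open>
  Arguments of instructions are addresses of memory cells, except for the constant in \<open>Const\<close>, the
  jump targets, and the iterator number in \<open>IterReset\<close> and \<open>IterNext\<close>. \<open>Load\<close> and \<open>Store\<close> address
  indirectly.
\<close>

datatype instr =
    Const nat nat
  | Copy nat nat
  | Add nat nat nat
  | Sub nat nat nat
  | Mul nat nat nat
  | Load nat nat
  | Store nat nat
  | Jump nat
  | JumpZero nat nat
  | Adj nat nat nat
  | IterReset nat
  | IterNext nat nat nat nat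

record ram_state =
  pc :: nat
  mem :: "nat \<Rightarrow> nat"
  cursor :: "nat \<Rightarrow> nat"

definition init_state :: ram_state where
  "init_state = \<lparr>pc = 0, mem = (\<lambda>_. 0), cursor = (\<lambda>_. 0)\<rparr>"

definition set_cell :: "nat \<Rightarrow> nat \<Rightarrow> ram_state \<Rightarrow> ram_state" where
  "set_cell a v s = s\<lparr>pc := Suc (pc s), mem := (mem s)(a := v)\<rparr>"

fun exec :: "host_rep \<Rightarrow> instr \<Rightarrow> ram_state \<Rightarrow> ram_state" where
  "exec R (Const a k) s = set_cell a k s"
| "exec R (Copy a b) s = set_cell a (mem s b) s"
| "exec R (Add a b c) s = set_cell a (mem s b + mem s c) s"
| "exec R (Sub a b c) s = set_cell a (mem s b - mem s c) s"
| "exec R (Mul a b c) s = set_cell a (mem s b * mem s c) s"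
| "exec R (Load a b) s = set_cell a (mem s (mem s b)) s"
| "exec R (Store a b) s = set_cell (mem s a) (mem s b) s"
| "exec R (Jump l) s = s\<lparr>pc := l\<rparr>"
| "exec R (JumpZero a l) s = s\<lparr>pc := (if mem s a = 0 then l else Suc (pc s))\<rparr>"
| "exec R (Adj a b c) s = set_cell a (if (mem s b, mem s c) \<in> parcs (host R) then 1 else 0) s"
| "exec R (IterReset j) s = s\<lparr>pc := Suc (pc s), cursor := (cursor s)(j := 0)\<rparr>"
| "exec R (IterNext j a b c) s =
     (if cursor s j < length (edge_seq R)
      then (let (x, y) = edge_seq R ! cursor s j in
        s\<lparr>pc := Suc (pc s),
          mem := (mem s)(a := x, b := y, c := 1),
          cursor := (cursor s)(j := Suc (cursor s j))\<rparr>)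
      else set_cell c 0 s)"

fun instr_cost :: "host_rep \<Rightarrow> instr \<Rightarrow> ram_state \<Rightarrow> nat" where
  "instr_cost R (Adj a b c) s = 1 + adj_cost R (mem s b) (mem s c)"
| "instr_cost R (IterReset j) s = 1 + reset_cost R"
| "instr_cost R (IterNext j a b c) s = 1 + next_cost R (cursor s j)"
| "instr_cost R _ s = 1"

fun cells_used :: "instr \<Rightarrow> ram_state \<Rightarrow> nat set" where
  "cells_used (Const a k) s = {a}"
| "cells_used (Copy a b) s = {a, b}"
| "cells_used (Add a b c) s = {a, b, c}"
| "cells_used (Sub a b c) s = {a, b, c}"
| "cells_used (Mul a b c) s = {a, b, c}"
| "cells_used (Load a b) s = {a, b, mem s b}"
| "cells_used (Store a b) s = {a, b, mem s a}"
| "cells_used (Jump l) s = {}"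
| "cells_used (JumpZero a l) s = {a}"
| "cells_used (Adj a b c) s = {a, b, c}"
| "cells_used (IterReset j) s = {}"
| "cells_used (IterNext j a b c) s = {a, b, c}"

fun iters_used :: "instr \<Rightarrow> nat set" where
  "iters_used (IterReset j) = {j}"
| "iters_used (IterNext j a b c) = {j}"
| "iters_used _ = {}"

definition halted :: "instr list \<Rightarrow> ram_state \<Rightarrow> bool" where
  "halted P s \<longleftrightarrow> length P \<le> pc s"

definition step :: "host_rep \<Rightarrow> instr list \<Rightarrow> ram_state \<Rightarrow> ram_state" where
  "step R P s = (if halted P s then s else exec R (P ! pc s) s)"

definition state_at :: "host_rep \<Rightarrow> instr list \<Rightarrow> nat \<Rightarrow> ram_state" where
  "state_at R P i = (step R P ^^ i) init_state"

definition time_upto :: "host_rep \<Rightarrow> instr list \<Rightarrow> nat \<Rightarrow> nat" where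
  "time_upto R P n = (\<Sum>i<n. instr_cost R (P ! pc (state_at R P i)) (state_at R P i))"

text \<open>An iterator is charged like a memory cell.\<close>

definition space_upto :: "host_rep \<Rightarrow> instr list \<Rightarrow> nat \<Rightarrow> nat" where
  "space_upto R P n =
     card (\<Union>i<n. cells_used (P ! pc (state_at R P i)) (state_at R P i))
     + card (\<Union>i<n. iters_used (P ! pc (state_at R P i)))"

text \<open>
  \<open>P\<close> halts on input \<open>R\<close> with \<open>out\<close> in cell 0, in time at most \<open>T\<close>, using at most \<open>S\<close> cells and
  iterators. Every cell holds at most \<open>b\<close> words of \<open>w\<close> bits throughout the run: this is what makes
  unit cost per arithmetic operation legitimate, and the space at most \<open>S * b\<close> words.
\<close>

definition computes_within ::
  "instr list \<Rightarrow> host_rep \<Rightarrow> nat \<Rightarrow> nat \<Rightarrow> real \<Rightarrow> nat \<Rightarrow> nat \<Rightarrow> bool" where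
  "computes_within P R w out T S b \<longleftrightarrow>
     (\<exists>n. (\<forall>i<n. \<not> halted P (state_at R P i)) \<and> halted P (state_at R P n)
        \<and> mem (state_at R P n) 0 = out
        \<and> real (time_upto R P n) \<le> T
        \<and> space_upto R P n \<le> S
        \<and> (\<forall>i\<le>n. \<forall>a. mem (state_at R P i) a < 2 ^ (b * w)))"

end

theory Submission
  imports Defs "HOL-Library.Nat_Bijection"
begin

text \<open>
  Walk down a matched elimination tree and enumerate the image of a vertex \<open>v\<close> by one pass over the
  edges \<open>(x, y)\<close> of the host, ordered by \<open>x\<close>. While \<open>x\<close> is the image of \<open>v\<close>, the second endpoint \<open>y\<close>
  simultaneously serves as the image of every child of \<open>v\<close> adjacent to \<open>v\<close>, whose own children then
  start new passes; a child that is not adjacent to \<open>v\<close> starts a pass of its own. Along a root-to-leaf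
  path the number of nested passes is thus the number of blocks of the greedy decomposition into
  edges and single vertices. On a matched path with \<open>k\<close> vertices there are at most \<open>\<lceil>k/2\<rceil>\<close> blocks:
  at the first single vertex the greedy decomposition falls into step with the pairs after the
  block of size 3, and is perfect from there on. Each pass costs a factor \<open>m\<close>, and only a constant
  number of counters per pattern vertex is stored.
\<close>

section \<open>A loop language and its compilation\<close>

text \<open>Constant space forbids storing a value for each image, so the children of
  \<open>v\<close> are treated in two ways during the pass for \<open>v\<close>. For an adjacent
  child, the arcs \<open>(x, y)\<close> with fixed \<open>x\<close> run exactly over its admissible
  images, and one accumulator collects the sum over \<open>y\<close>. Any other child recomputes its
  whole count for every arc, not once for every \<open>x\<close>; the value stays the same, and its
  passes are charged a factor \<open>m\<close> per level anyway. The obstacle is that the product of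
  these sums over the children is not additive in the arcs; hence the contribution of
  \<open>x\<close> is revised after each arc. Passes only meet host vertices that have a neighbour.
  Nothing is lost: a pattern with a matched elimination tree has at least two vertices and, being
  connected, no isolated one. Counts are at most \<open>(2 ^ w) ^ n\<close> for \<open>n\<close>
  pattern vertices, and every intermediate value fits into \<open>n + 2\<close> words.\<close>

datatype exp = Cst nat | Var nat | Pls nat nat | Mns nat nat | Tms nat nat | Arc nat nat

text \<open>There is neither a conditional nor indirect addressing: tests become factors 0 or 1, and
  a loop always runs through all of \<open>edge_seq\<close>. Time and space can thus be bounded from
  the shape of the program. The numbers in \<open>Loop\<close> are the machine iterator and the
  cells for source, target and end flag.\<close>

datatype com = Skip | Let nat exp | Seq com com | Loop nat nat nat nat com

fun val :: "host_rep \<Rightarrow> exp \<Rightarrow> (nat \<Rightarrow> nat) \<Rightarrow> nat" where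
  "val R (Cst n) m = n"
| "val R (Var a) m = m a"
| "val R (Pls a b) m = m a + m b"
| "val R (Mns a b) m = m a - m b"
| "val R (Tms a b) m = m a * m b"
| "val R (Arc a b) m = (if (m a, m b) \<in> parcs (host R) then 1 else 0)"

fun arc_ok :: "host_rep \<Rightarrow> exp \<Rightarrow> (nat \<Rightarrow> nat) \<Rightarrow> bool" where
  "arc_ok R (Arc a b) m = (m a \<in> pverts (host R) \<and> m b \<in> pverts (host R))"
| "arc_ok R _ m = True"

text \<open>
  The memory update performed by \<open>IterNext\<close> is a constant of its own: written with \<open>fun_upd\<close>, it
  is rewritten under the binders of \<open>fold\<close> and facts about loops no longer match.
\<close>

definition enter :: "nat \<Rightarrow> nat \<Rightarrow> nat \<Rightarrow> nat \<times> nat \<Rightarrow> (nat \<Rightarrow> nat) \<Rightarrow> nat \<Rightarrow> nat" where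
  "enter a b f e m = m(a := fst e, b := snd e, f := 1)"

lemma enter_bounded:
  assumes "fst e < B" "snd e < B" "1 < B" "\<And>z. m z < B"
  shows "enter a b f e m z < B"
  using assms by (auto simp: enter_def)

fun sem :: "host_rep \<Rightarrow> com \<Rightarrow> (nat \<Rightarrow> nat) \<Rightarrow> nat \<Rightarrow> nat" where
  "sem R Skip m = m"
| "sem R (Let a e) m = m(a := val R e m)"
| "sem R (Seq c d) m = sem R d (sem R c m)"
| "sem R (Loop j a b f c) m =
     (fold (\<lambda>e m. sem R c (enter a b f e m)) (edge_seq R) m)(f := 0)"

text \<open>
  Every value written is below \<open>B\<close>, and arc queries are only asked about vertices of the host, where
  their cost is bounded.
\<close>

fun safe :: "host_rep \<Rightarrow> nat \<Rightarrow> com \<Rightarrow> (nat \<Rightarrow> nat) \<Rightarrow> bool" where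
  "safe R B Skip m = True"
| "safe R B (Let a e) m = (val R e m < B \<and> arc_ok R e m)"
| "safe R B (Seq c d) m = (safe R B c m \<and> safe R B d (sem R c m))"
| "safe R B (Loop j a b f c) m = (\<forall>i<length (edge_seq R).
     fst (edge_seq R ! i) < B \<and> snd (edge_seq R ! i) < B
     \<and> safe R B c (enter a b f (edge_seq R ! i)
          (fold (\<lambda>e m. sem R c (enter a b f e m)) (take i (edge_seq R)) m)))"

primrec iters :: "com \<Rightarrow> nat set" where
  "iters Skip = {}"
| "iters (Let a e) = {}"
| "iters (Seq c d) = iters c \<union> iters d"
| "iters (Loop j a b f c) = insert j (iters c)"

primrec wf_com :: "com \<Rightarrow> bool" where
  "wf_com Skip = True"
| "wf_com (Let a e) = True"
| "wf_com (Seq c d) = (wf_com c \<and> wf_com d)"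
| "wf_com (Loop j a b f c) = (j \<notin> iters c \<and> wf_com c)"

primrec nest :: "com \<Rightarrow> nat" where
  "nest Skip = 0"
| "nest (Let a e) = 0"
| "nest (Seq c d) = max (nest c) (nest d)"
| "nest (Loop j a b f c) = Suc (nest c)"

section \<open>Compilation to RAM code and its execution\<close>

fun let_instr :: "nat \<Rightarrow> exp \<Rightarrow> instr" where
  "let_instr a (Cst n) = Const a n"
| "let_instr a (Var b) = Copy a b"
| "let_instr a (Pls b c) = Add a b c"
| "let_instr a (Mns b c) = Sub a b c"
| "let_instr a (Tms b c) = Mul a b c"
| "let_instr a (Arc b c) = Adj a b c"

primrec clen :: "com \<Rightarrow> nat" where
  "clen Skip = 0"
| "clen (Let a e) = 1"
| "clen (Seq c d) = clen c + clen d"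
| "clen (Loop j a b f c) = clen c + 4"

primrec compile :: "nat \<Rightarrow> com \<Rightarrow> instr list" where
  "compile p Skip = []"
| "compile p (Let a e) = [let_instr a e]"
| "compile p (Seq c d) = compile p c @ compile (p + clen c) d"
| "compile p (Loop j a b f c) =
     [IterReset j, IterNext j a b f, JumpZero f (p + clen c + 4)] @ compile (p + 3) c @ [Jump (p + 1)]"

lemma length_compile [simp]: "length (compile p c) = clen c"
  by (induction c arbitrary: p) auto

text \<open>Fragments of a run starting in an arbitrary state, so that they can be concatenated;
  \<open>state_at\<close> and \<open>time_upto\<close> only speak of runs from
  \<open>init_state\<close>. The bound \<open>B\<close> covers all cells in every state visited,
  including the last, as \<open>computes_within\<close> demands.\<close>

inductive runs :: "host_rep \<Rightarrow> nat \<Rightarrow> instr list \<Rightarrow> ram_state \<Rightarrow> nat \<Rightarrow> ram_state \<Rightarrow> bool"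
  for R B P where
  runs_refl: "(\<And>a. mem s a < B) \<Longrightarrow> runs R B P s 0 s"
| runs_step: "pc s < length P \<Longrightarrow> (\<And>a. mem s a < B) \<Longrightarrow> runs R B P (exec R (P ! pc s) s) t s'
    \<Longrightarrow> runs R B P s (instr_cost R (P ! pc s) s + t) s'"

lemma runs_trans:
  "runs R B P s t s' \<Longrightarrow> runs R B P s' t' s'' \<Longrightarrow> runs R B P s (t + t') s''"
  by (induction rule: runs.induct) (auto simp: add.assoc intro: runs_step)

lemma runs_single:
  assumes "pc s < length P" "\<And>a. mem s a < B" "\<And>a. mem (exec R (P ! pc s) s) a < B"
  shows "runs R B P s (instr_cost R (P ! pc s) s) (exec R (P ! pc s) s)"
  using runs_step[OF assms(1,2) runs_refl[OF assms(3)]] by simp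

lemma runs_single':
  assumes "exec R (P ! pc s) s = s'" "instr_cost R (P ! pc s) s = t"
    and "pc s < length P" "\<And>a. mem s a < B" "\<And>a. mem s' a < B"
  shows "runs R B P s t s'"
  using runs_single assms by blast

lemma runs_steps:
  assumes "runs R B P s t s'"
  shows "\<exists>n. s' = (step R P ^^ n) s \<and> (\<forall>i<n. \<not> halted P ((step R P ^^ i) s))
    \<and> t = (\<Sum>i<n. instr_cost R (P ! pc ((step R P ^^ i) s)) ((step R P ^^ i) s))
    \<and> (\<forall>i\<le>n. \<forall>a. mem ((step R P ^^ i) s) a < B)"
  using assms
proof (induction rule: runs.induct)
  case (runs_refl s)
  then show ?case by (intro exI[of _ 0]) auto
next
  case (runs_step s t s')
  then obtain n where n: "s' = (step R P ^^ n) (exec R (P ! pc s) s)"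
    "\<forall>i<n. \<not> halted P ((step R P ^^ i) (exec R (P ! pc s) s))"
    "t = (\<Sum>i<n. instr_cost R (P ! pc ((step R P ^^ i) (exec R (P ! pc s) s)))
       ((step R P ^^ i) (exec R (P ! pc s) s)))"
    "\<forall>i\<le>n. \<forall>a. mem ((step R P ^^ i) (exec R (P ! pc s) s)) a < B"
    by blast
  have e: "exec R (P ! pc s) s = step R P s" "\<not> halted P s"
    using runs_step.hyps(1) by (auto simp: step_def halted_def)
  have sh: "(step R P ^^ i) (step R P s) = (step R P ^^ Suc i) s" for i
    by (simp add: funpow_swap1)
  note n' = n[unfolded e(1) sh]
  show ?case
  proof (intro exI[of _ "Suc n"] conjI allI impI)
    show "s' = (step R P ^^ Suc n) s" using n'(1) .
    show "\<not> halted P ((step R P ^^ i) s)" if "i < Suc n" for i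
      using that n'(2) e(2) by (cases i) (auto simp del: funpow.simps(2))
    show "instr_cost R (P ! pc s) s + t =
      (\<Sum>i<Suc n. instr_cost R (P ! pc ((step R P ^^ i) s)) ((step R P ^^ i) s))"
      unfolding n'(3) by (subst sum.lessThan_Suc_shift) simp
    show "mem ((step R P ^^ i) s) a < B" if "i \<le> Suc n" for i a
      using that n'(4) runs_step.hyps(2) by (cases i) (auto simp del: funpow.simps(2))
  qed
qed

text \<open>The advances of an iterator are charged as one full pass because
  \<open>valid_rep\<close> bounds their cost only amortised. The first 3 pays for
  \<open>IterReset\<close> and the last \<open>IterNext\<close> and \<open>JumpZero\<close>; the
  second for \<open>IterNext\<close>, \<open>JumpZero\<close> and \<open>Jump\<close> in each round.
  Here \<open>q\<close> bounds the cost of an adjacency query.\<close>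

primrec time_bound :: "real \<Rightarrow> host_rep \<Rightarrow> com \<Rightarrow> real" where
  "time_bound q R Skip = 0"
| "time_bound q R (Let a e) = 1 + q"
| "time_bound q R (Seq c d) = time_bound q R c + time_bound q R d"
| "time_bound q R (Loop j a b f c) = 3 + real (reset_cost R + (\<Sum>i\<le>length (edge_seq R). next_cost R i))
     + real (length (edge_seq R)) * (3 + time_bound q R c)"

lemma safe_bounded:
  assumes "safe R B c m" "\<And>a. m a < B" "1 < B"
  shows "sem R c m a < B"
  using assms
proof (induction c arbitrary: m a)
  case (Loop j p q f c)
  let ?g = "\<lambda>e m. sem R c (enter p q f e m)"
  have "\<forall>a. fold ?g (take i (edge_seq R)) m a < B" if "i \<le> length (edge_seq R)" for i
    using that
  proof (induction i)
    case (Suc i)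
    let ?m = "enter p q f (edge_seq R ! i) (fold ?g (take i (edge_seq R)) m)"
    have *: "fst (edge_seq R ! i) < B" "snd (edge_seq R ! i) < B" "safe R B c ?m"
      using Loop.prems(1) Suc.prems by auto
    have "sem R c ?m a < B" for a
      by (rule Loop.IH[OF *(3)]) (use * Suc Loop.prems(3) in \<open>auto intro: enter_bounded\<close>)
    then show ?case using Suc.prems by (simp add: take_Suc_conv_app_nth)
  qed (use Loop.prems in auto)
  from this[of "length (edge_seq R)"] show ?case using Loop.prems(3) by auto
qed auto

text \<open>Jump targets are absolute, hence the code is placed between arbitrary \<open>pre\<close>
  and \<open>post\<close>. That foreign cursors survive is what an enclosing loop needs from its
  body, and the reason for the freshness condition in \<open>wf_com\<close>.\<close>

lemma compile_runs:
  assumes "safe R B c m" "wf_com c" "\<And>a. m a < B" "1 < B"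
    and "P = pre @ compile (length pre) c @ post" "0 \<le> q"
    and "\<And>x y. x \<in> pverts (host R) \<Longrightarrow> y \<in> pverts (host R) \<Longrightarrow> real (adj_cost R x y) \<le> q"
  shows "\<exists>t cu'. runs R B P \<lparr>pc = length pre, mem = m, cursor = cu\<rparr> t
      \<lparr>pc = length pre + clen c, mem = sem R c m, cursor = cu'\<rparr>
    \<and> real t \<le> time_bound q R c \<and> (\<forall>j. j \<notin> iters c \<longrightarrow> cu' j = cu j)"
  using assms(1-5)
proof (induction c arbitrary: m pre post cu)
  case Skip
  then show ?case by (intro exI[of _ 0] exI[of _ cu]) (auto intro: runs_refl)
next
  case (Let a e)
  let ?s = "\<lparr>pc = length pre, mem = m, cursor = cu\<rparr>"
  have P: "P ! length pre = let_instr a e" "length pre < length P" using Let.prems(5) by auto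
  have ex: "exec R (let_instr a e) ?s = \<lparr>pc = Suc (length pre), mem = m(a := val R e m), cursor = cu\<rparr>"
    by (cases e) (auto simp: set_cell_def)
  have "runs R B P ?s (instr_cost R (P ! pc ?s) ?s) (exec R (P ! pc ?s) ?s)"
    by (rule runs_single) (use Let.prems P ex in \<open>auto\<close>)
  moreover have "real (instr_cost R (let_instr a e) ?s) \<le> 1 + q"
    using Let.prems(1) assms(6,7) by (cases e) auto
  ultimately show ?case using P ex by (auto simp del: fun_upd_apply)
next
  case (Seq c d)
  obtain t cu1 where 1: "runs R B P \<lparr>pc = length pre, mem = m, cursor = cu\<rparr> t
      \<lparr>pc = length pre + clen c, mem = sem R c m, cursor = cu1\<rparr>"
    "real t \<le> time_bound q R c" "\<forall>j. j \<notin> iters c \<longrightarrow> cu1 j = cu j"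
    using Seq.IH(1)[of m pre "compile (length pre + clen c) d @ post" cu] Seq.prems by auto
  have b: "\<And>a. sem R c m a < B" using safe_bounded Seq.prems by auto
  obtain t' cu2 where 2: "runs R B P \<lparr>pc = length pre + clen c, mem = sem R c m, cursor = cu1\<rparr> t'
      \<lparr>pc = length pre + clen c + clen d, mem = sem R d (sem R c m), cursor = cu2\<rparr>"
    "real t' \<le> time_bound q R d" "\<forall>j. j \<notin> iters d \<longrightarrow> cu2 j = cu1 j"
    using Seq.IH(2)[of "sem R c m" "pre @ compile (length pre) c" post cu1] Seq.prems b by auto
  show ?case
    by (intro exI[of _ "t + t'"] exI[of _ cu2]) (use runs_trans[OF 1(1) 2(1)] 1 2 in \<open>auto simp: add.assoc\<close>)
next
  case (Loop j a b f c)
  let ?n = "length pre" and ?es = "edge_seq R"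
  let ?g = "\<lambda>e m. sem R c (enter a b f e m)"
  let ?m = "\<lambda>i. fold ?g (take i ?es) m"
  have P: "P ! ?n = IterReset j" "P ! Suc ?n = IterNext j a b f"
    "P ! Suc (Suc ?n) = JumpZero f (?n + clen c + 4)" "P ! (?n + 3 + clen c) = Jump (Suc ?n)"
    "length P = ?n + clen c + 4 + length post"
    using Loop.prems(5) by (auto simp: nth_append nth_Cons split: nat.splits)
  \<comment> \<open>The head of the loop moves into the prefix, so that the induction hypothesis
    applies to the body.\<close>
  have P': "P = (pre @ [IterReset j, IterNext j a b f, JumpZero f (?n + clen c + 4)])
      @ compile (length (pre @ [IterReset j, IterNext j a b f, JumpZero f (?n + clen c + 4)])) c
      @ (Jump (?n + 1) # post)"
    using Loop.prems(5) by (simp add: eval_nat_numeral)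
  \<comment> \<open>Invariant at the loop head, just before \<open>IterNext\<close>: the advance
    from position \<open>i\<close> is not yet paid for.\<close>
  have main: "\<exists>t cu'. runs R B P \<lparr>pc = ?n, mem = m, cursor = cu\<rparr> t
      \<lparr>pc = Suc ?n, mem = ?m i, cursor = cu'\<rparr>
      \<and> real t \<le> 1 + real (reset_cost R) + (\<Sum>k<i. real (next_cost R k)) + real i * (3 + time_bound q R c)
      \<and> cu' j = i \<and> (\<forall>j'. j' \<notin> insert j (iters c) \<longrightarrow> cu' j' = cu j') \<and> (\<forall>a. ?m i a < B)"
    if "i \<le> length ?es" for i
    using that
  proof (induction i)
    case 0
    have "runs R B P \<lparr>pc = ?n, mem = m, cursor = cu\<rparr>
      (instr_cost R (P ! pc \<lparr>pc = ?n, mem = m, cursor = cu\<rparr>) \<lparr>pc = ?n, mem = m, cursor = cu\<rparr>)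
      (exec R (P ! pc \<lparr>pc = ?n, mem = m, cursor = cu\<rparr>) \<lparr>pc = ?n, mem = m, cursor = cu\<rparr>)"
      by (rule runs_single) (use Loop.prems P in auto)
    then show ?case using P Loop.prems
      by (intro exI[of _ "1 + reset_cost R"] exI[of _ "cu(j := 0)"]) (auto simp del: fun_upd_apply, simp_all)
  next
    case (Suc i)
    then obtain t cu' where I: "runs R B P \<lparr>pc = ?n, mem = m, cursor = cu\<rparr> t
      \<lparr>pc = Suc ?n, mem = ?m i, cursor = cu'\<rparr>"
      "real t \<le> 1 + real (reset_cost R) + (\<Sum>k<i. real (next_cost R k)) + real i * (3 + time_bound q R c)"
      "cu' j = i" "\<forall>j'. j' \<notin> insert j (iters c) \<longrightarrow> cu' j' = cu j'" "\<And>a. ?m i a < B"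
      by auto
    let ?m1 = "enter a b f (?es ! i) (?m i)"
    have sf: "fst (?es ! i) < B" "snd (?es ! i) < B" "safe R B c ?m1"
      using Loop.prems(1) Suc.prems by auto
    have m1: "?m1 z < B" for z using sf I(5) Loop.prems(4) by (auto intro: enter_bounded)
    define cu1 where "cu1 = cu'(j := Suc i)"
    define s1 where "s1 = \<lparr>pc = Suc ?n, mem = ?m i, cursor = cu'\<rparr>"
    define s2 where "s2 = \<lparr>pc = Suc (Suc ?n), mem = ?m1, cursor = cu1\<rparr>"
    define s3 where "s3 = \<lparr>pc = ?n + 3, mem = ?m1, cursor = cu1\<rparr>"
    have e1: "exec R (P ! pc s1) s1 = s2" "instr_cost R (P ! pc s1) s1 = 1 + next_cost R i"
      using P I(3) Suc.prems by (auto simp: s1_def s2_def enter_def cu1_def split: prod.split)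
    have r1: "runs R B P s1 (1 + next_cost R i) s2"
      by (rule runs_single'[OF e1]) (use P I(5) m1 in \<open>auto simp: s1_def s2_def\<close>)
    have e2: "exec R (P ! pc s2) s2 = s3" "instr_cost R (P ! pc s2) s2 = 1"
      using P by (auto simp: s2_def s3_def enter_def)
    have r2: "runs R B P s2 1 s3"
      by (rule runs_single'[OF e2]) (use P m1 in \<open>auto simp: s2_def s3_def\<close>)
    obtain tb cu2 where r3: "runs R B P s3 tb
        \<lparr>pc = ?n + 3 + clen c, mem = sem R c ?m1, cursor = cu2\<rparr>"
      "real tb \<le> time_bound q R c" "\<forall>j'. j' \<notin> iters c \<longrightarrow> cu2 j' = cu1 j'"
      using Loop.IH[OF sf(3) _ m1 Loop.prems(4) P', of cu1] Loop.prems(2)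
      by (auto simp: s3_def eval_nat_numeral)
    have b3: "sem R c ?m1 z < B" for z using safe_bounded[OF sf(3)] m1 Loop.prems(4) by blast
    define s4 where "s4 = \<lparr>pc = ?n + 3 + clen c, mem = sem R c ?m1, cursor = cu2\<rparr>"
    define s5 where "s5 = \<lparr>pc = Suc ?n, mem = sem R c ?m1, cursor = cu2\<rparr>"
    have e4: "exec R (P ! pc s4) s4 = s5" "instr_cost R (P ! pc s4) s4 = 1"
      using P by (auto simp: s4_def s5_def)
    have r4: "runs R B P s4 1 s5"
      by (rule runs_single'[OF e4]) (use P b3 in \<open>auto simp: s4_def s5_def\<close>)
    have mi: "?m (Suc i) = sem R c ?m1" using Suc.prems by (simp add: take_Suc_conv_app_nth)
    have "runs R B P \<lparr>pc = ?n, mem = m, cursor = cu\<rparr> (t + (1 + next_cost R i + (1 + (tb + 1)))) s5"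
      using runs_trans[OF I(1)[folded s1_def] runs_trans[OF r1 runs_trans[OF r2
            runs_trans[OF r3(1)[folded s4_def] r4]]]] .
    then show ?case
      by (intro exI[of _ "t + (1 + next_cost R i + (1 + (tb + 1)))"] exI[of _ cu2])
        (use I r3 Loop.prems(2) b3 in \<open>auto simp: mi s5_def cu1_def algebra_simps\<close>)
  qed
  from main[OF order_refl] obtain t cu' where I: "runs R B P \<lparr>pc = ?n, mem = m, cursor = cu\<rparr> t
      \<lparr>pc = Suc ?n, mem = fold ?g ?es m, cursor = cu'\<rparr>"
      "real t \<le> 1 + real (reset_cost R) + (\<Sum>k<length ?es. real (next_cost R k))
        + real (length ?es) * (3 + time_bound q R c)"
      "cu' j = length ?es" "\<forall>j'. j' \<notin> insert j (iters c) \<longrightarrow> cu' j' = cu j'" "\<And>a. fold ?g ?es m a < B"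
    by auto
  define s1 where "s1 = \<lparr>pc = Suc ?n, mem = fold ?g ?es m, cursor = cu'\<rparr>"
  define s2 where "s2 = \<lparr>pc = Suc (Suc ?n), mem = (fold ?g ?es m)(f := 0), cursor = cu'\<rparr>"
  define s3 where "s3 = \<lparr>pc = ?n + clen c + 4, mem = (fold ?g ?es m)(f := 0), cursor = cu'\<rparr>"
  have e1: "exec R (P ! pc s1) s1 = s2" "instr_cost R (P ! pc s1) s1 = 1 + next_cost R (length ?es)"
    using P I(3) by (auto simp: s1_def s2_def set_cell_def)
  have r1: "runs R B P s1 (1 + next_cost R (length ?es)) s2"
    by (rule runs_single'[OF e1]) (use P I(5) Loop.prems(4) in \<open>auto simp: s1_def s2_def\<close>)
  have e2: "exec R (P ! pc s2) s2 = s3" "instr_cost R (P ! pc s2) s2 = 1"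
    using P by (auto simp: s2_def s3_def)
  have r2: "runs R B P s2 1 s3"
    by (rule runs_single'[OF e2]) (use P I(5) Loop.prems(4) in \<open>auto simp: s2_def s3_def\<close>)
  have sm: "(\<Sum>i\<le>length ?es. real (next_cost R i))
      = (\<Sum>i<length ?es. real (next_cost R i)) + real (next_cost R (length ?es))"
    by (simp flip: lessThan_Suc_atMost)
  show ?case
    by (intro exI[of _ "t + (1 + next_cost R (length ?es) + 1)"] exI[of _ cu'])
      (use runs_trans[OF I(1)[folded s1_def] runs_trans[OF r1 r2]] I sm in \<open>auto simp: s3_def add.assoc simp del: fun_upd_apply\<close>)
qed

section \<open>Time and space of compiled programs\<close>

primrec time_const :: "real \<Rightarrow> com \<Rightarrow> real" where
  "time_const q Skip = 0"
| "time_const q (Let a e) = 1 + q"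
| "time_const q (Seq c d) = time_const q c + time_const q d"
| "time_const q (Loop j a b f c) = 9 + q + 2 * time_const q c"

text \<open>The edge and one bit for its orientation determine an arc; this gives the factor 2
  between arcs and edges.\<close>

lemma inj_on_edge_direction: "inj_on (\<lambda>(u, v). ({u, v}, u < v)) (S :: (nat \<times> nat) set)"
proof (rule inj_onI, clarify)
  fix a b c d :: nat
  assume "{a, b} = {c, d}" and lt: "(a < b) = (c < d)"
  then consider "a = c" "b = d" | "a = d" "b = c" by (auto simp only: doubleton_eq_iff)
  then show "a = c \<and> b = d" using lt by cases auto
qed
lemma card_arcs_le:
  fixes H :: "nat pair_pre_digraph"
  assumes fin: "finite (parcs H)"
  shows "card (parcs H) \<le> 2 * num_edges H"
proof -
  let ?S = "((\<lambda>(u, v). {u, v}) ` parcs H) \<times> (UNIV :: bool set)"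
  have "(\<lambda>(u, v). ({u, v}, u < v)) ` parcs H \<subseteq> ?S" by auto
  moreover have "finite ?S" using fin by simp
  ultimately have "card (parcs H) \<le> card ?S" by (rule card_inj_on_le[OF inj_on_edge_direction])
  then show ?thesis by (simp add: num_edges_def card_cartesian_product)
qed

lemma time_const_nonneg: "0 \<le> q \<Longrightarrow> 0 \<le> time_const q c"
  by (induction c) auto

text \<open>Nesting multiplies only the numbers of rounds, at most \<open>2 * M\<close> each, while
  the polylogarithmic \<open>L\<close> enters additively at each level. It therefore appears once,
  not once per level. The 9 in \<open>time_const\<close> is 3 outside the rounds plus
  \<open>2 * 3\<close> inside.\<close>

lemma time_bound_le:
  fixes M L q :: real
  assumes "1 \<le> M" "1 \<le> L" "0 \<le> q" "real (length (edge_seq R)) \<le> 2 * M"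
    and pass: "real (reset_cost R + (\<Sum>i\<le>length (edge_seq R). next_cost R i)) \<le> q * M * L"
  shows "time_bound (q * L) R c \<le> time_const q c * M ^ nest c * L"
proof (induction c)
  case (Let a e)
  then show ?case using assms by (simp add: algebra_simps)
next
  case (Seq c d)
  have "time_const q c * M ^ nest c * L \<le> time_const q c * M ^ max (nest c) (nest d) * L"
    "time_const q d * M ^ nest d * L \<le> time_const q d * M ^ max (nest c) (nest d) * L"
    using assms time_const_nonneg
    by (auto intro!: mult_right_mono mult_left_mono power_increasing)
  with Seq show ?case by (simp add: algebra_simps)
next
  case (Loop j a b f c)
  let ?T = "time_const q c * M ^ nest c * L"
  have 1: "1 \<le> M ^ nest c" using assms by simp
  have "M * 1 * 1 \<le> M * M ^ nest c * L" "1 * 1 * 1 \<le> M * M ^ nest c * L"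
    using assms 1 by (intro mult_mono; simp add: mult_le_one)+
  moreover have "q * M * L * 1 \<le> q * M * L * M ^ nest c"
    using assms 1 by (intro mult_left_mono) auto
  moreover have "real (length (edge_seq R)) * (3 + time_bound (q * L) R c) \<le> 2 * M * (3 + ?T)"
    using assms Loop time_const_nonneg[of q c]
    by (intro order_trans[OF mult_left_mono mult_right_mono]) auto
  ultimately show ?case using pass by (simp add: algebra_simps)
qed simp

text \<open>Compiled code contains no \<open>Load\<close> or \<open>Store\<close>, so the cells of
  an instruction do not depend on the state and \<open>init_state\<close> may stand for any other.
  The result is a constant of the program.\<close>

definition program_space :: "instr list \<Rightarrow> nat" where
  "program_space P = card (\<Union>i\<in>set P. cells_used i init_state) + card (\<Union>i\<in>set P. iters_used i)"

lemma cells_used_compile: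
  "i \<in> set (compile p c) \<Longrightarrow> cells_used i s = cells_used i s'"
proof (induction c arbitrary: p)
  case (Let a e)
  then show ?case by (cases e) auto
qed auto

lemma finite_cells_used [simp]: "finite (cells_used i s)"
  by (cases i) auto

lemma finite_iters_used [simp]: "finite (iters_used i)"
  by (cases i) auto

lemma computes_within_compile:
  assumes rep: "valid_rep c\<^sub>0 k\<^sub>0 w R" and sf: "safe R (2 ^ (b * w)) c (\<lambda>_. 0)" and wf: "wf_com c"
    and b: "0 < b" and out: "sem R c (\<lambda>_. 0) 0 = out" and e: "nest c \<le> e"
  shows "computes_within (compile 0 c) R w out
    (soft_bound (time_const c\<^sub>0 c) k\<^sub>0 e (host R)) (program_space (compile 0 c)) b"
proof -
  let ?P = "compile 0 c" and ?B = "2 ^ (b * w) :: nat"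
  let ?M = "real (max 1 (num_edges (host R)))" and ?L = "log 2 (real (input_size (host R) + 2)) ^ k\<^sub>0"
  have L: "1 \<le> ?L" by (rule one_le_power) simp
  have pass: "real (reset_cost R + (\<Sum>i\<le>length (edge_seq R). next_cost R i)) \<le> c\<^sub>0 * ?M * ?L"
    and adj: "\<And>x y. x \<in> pverts (host R) \<Longrightarrow> y \<in> pverts (host R) \<Longrightarrow> real (adj_cost R x y) \<le> c\<^sub>0 * ?L"
    and w: "0 < w" and pg: "pair_graph (host R)"
    and es: "set (edge_seq R) = parcs (host R)" "distinct (edge_seq R)"
    using rep by (auto simp: valid_rep_def soft_bound_def)
  \<comment> \<open>The sign of \<open>c\<^sub>0\<close> is not given, but a bound on costs, which
    are natural numbers, forces it.\<close>
  have "0 \<le> c\<^sub>0 * (?M * ?L)" using order_trans[OF of_nat_0_le_iff pass] by (simp only: mult.assoc)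
  moreover have "0 < ?M * ?L" using L by (intro mult_pos_pos) auto
  ultimately have c0: "0 \<le> c\<^sub>0" by (metis zero_le_mult_iff linorder_not_less)
  interpret pair_graph "host R" by fact
  have "length (edge_seq R) \<le> 2 * num_edges (host R)"
    using card_arcs_le[of "host R"] es distinct_card[of "edge_seq R"] by simp
  then have len: "real (length (edge_seq R)) \<le> 2 * ?M" by simp
  have B: "1 < ?B" using b w by (intro one_less_power) auto
  obtain t cu where r: "runs R ?B ?P \<lparr>pc = 0, mem = (\<lambda>_. 0), cursor = (\<lambda>_. 0)\<rparr> t
      \<lparr>pc = clen c, mem = sem R c (\<lambda>_. 0), cursor = cu\<rparr>"
    and t: "real t \<le> time_bound (c\<^sub>0 * ?L) R c"
    using compile_runs[OF sf wf _ B, of ?P "[]" "[]" "c\<^sub>0 * ?L" "\<lambda>_. 0"] adj c0 L by auto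
  obtain n where n: "\<lparr>pc = clen c, mem = sem R c (\<lambda>_. 0), cursor = cu\<rparr> = state_at R ?P n"
    "\<forall>i<n. \<not> halted ?P (state_at R ?P i)" "t = time_upto R ?P n"
    "\<forall>i\<le>n. \<forall>a. mem (state_at R ?P i) a < ?B"
    using runs_steps[OF r] unfolding state_at_def init_state_def time_upto_def by auto
  have "real t \<le> time_const c\<^sub>0 c * ?M ^ nest c * ?L"
    using time_bound_le[OF _ L c0 len pass, of c] t by simp
  also have "\<dots> \<le> time_const c\<^sub>0 c * ?M ^ e * ?L"
    using e L time_const_nonneg[OF c0] by (intro mult_right_mono mult_left_mono power_increasing) auto
  finally have T: "real (time_upto R ?P n) \<le> soft_bound (time_const c\<^sub>0 c) k\<^sub>0 e (host R)"
    unfolding n(3) soft_bound_def .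
  have mem: "?P ! pc (state_at R ?P i) \<in> set ?P" if "i < n" for i
    using n(2) that by (auto simp: halted_def)
  have "(\<Union>i<n. cells_used (?P ! pc (state_at R ?P i)) (state_at R ?P i))
      \<subseteq> (\<Union>i\<in>set ?P. cells_used i init_state)"
  proof (rule UN_least)
    fix i assume "i \<in> {..<n}"
    then show "cells_used (?P ! pc (state_at R ?P i)) (state_at R ?P i) \<subseteq> (\<Union>i\<in>set ?P. cells_used i init_state)"
      using UN_upper[OF mem] cells_used_compile[OF mem] by (metis lessThan_iff)
  qed
  moreover have "(\<Union>i<n. iters_used (?P ! pc (state_at R ?P i))) \<subseteq> (\<Union>i\<in>set ?P. iters_used i)"
    using mem by (intro UN_least UN_upper) simp
  ultimately have S: "space_upto R ?P n \<le> program_space ?P"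
    unfolding space_upto_def program_space_def by (intro add_mono card_mono) auto
  have "halted ?P (state_at R ?P n)" "mem (state_at R ?P n) 0 = out"
    using out by (auto simp: halted_def simp flip: n(1))
  then show ?thesis unfolding computes_within_def using n(2,4) T S by blast
qed

section \<open>Counting homomorphisms along a tree\<close>

fun top_vertex :: "'a rtree \<Rightarrow> 'a" where
  "top_vertex (Node v ts) = v"

fun preorder :: "'a rtree \<Rightarrow> 'a list" where
  "preorder (Node v ts) = v # concat (map preorder ts)"

definition fits :: "('a \<times> 'a) set \<Rightarrow> ('b \<times> 'b) set \<Rightarrow> 'a list \<Rightarrow> 'a \<Rightarrow> ('a \<Rightarrow> 'b) \<Rightarrow> nat" where
  "fits E A anc v \<phi> = of_bool (\<forall>u\<in>set anc. (u, v) \<in> E \<longrightarrow> (\<phi> u, \<phi> v) \<in> A)"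

text \<open>Arcs are tested only against ancestors because in an elimination tree every pattern edge
  joins a vertex to one of its ancestors. Images range over the sources of arcs, which are the
  vertices that a pass meets.\<close>

fun tree_count :: "('a \<times> 'a) set \<Rightarrow> ('b \<times> 'b) set \<Rightarrow> 'a list \<Rightarrow> 'a rtree \<Rightarrow> ('a \<Rightarrow> 'b) \<Rightarrow> nat" where
  "tree_count E A anc (Node v ts) \<phi> =
     (\<Sum>x\<in>fst ` A. fits E A anc v (\<phi>(v := x)) * (\<Prod>t\<leftarrow>ts. tree_count E A (v # anc) t (\<phi>(v := x))))"

text \<open>The variant for a root whose image is already chosen, as for a child that takes the
  second endpoint of the current arc.\<close>

fun rooted_count :: "('a \<times> 'a) set \<Rightarrow> ('b \<times> 'b) set \<Rightarrow> 'a list \<Rightarrow> 'a rtree \<Rightarrow> ('a \<Rightarrow> 'b) \<Rightarrow> nat" where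
  "rooted_count E A anc (Node v ts) \<phi> = fits E A anc v \<phi> * (\<Prod>t\<leftarrow>ts. tree_count E A (v # anc) t \<phi>)"

lemma tree_count_eq_sum_rooted_count: "tree_count E A anc t \<phi> = (\<Sum>x\<in>fst ` A. rooted_count E A anc t (\<phi>(top_vertex t := x)))"
  by (cases t) simp

lemma fits_cong: "(\<And>u. u \<in> set (v # anc) \<Longrightarrow> \<phi> u = \<psi> u) \<Longrightarrow> fits E A anc v \<phi> = fits E A anc v \<psi>"
  by (simp add: fits_def)

lemma fits_le_1: "fits E A anc v \<phi> \<le> 1"
  by (simp add: fits_def)

lemma tree_count_cong: "(\<And>u. u \<in> set anc \<Longrightarrow> \<phi> u = \<psi> u) \<Longrightarrow> tree_count E A anc t \<phi> = tree_count E A anc t \<psi>"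
proof (induction t arbitrary: anc \<phi> \<psi>)
  case (Node v ts)
  have "fits E A anc v (\<phi>(v := x)) = fits E A anc v (\<psi>(v := x))" for x
    using Node.prems by (intro fits_cong) auto
  moreover have "tree_count E A (v # anc) t (\<phi>(v := x)) = tree_count E A (v # anc) t (\<psi>(v := x))" if "t \<in> set ts" for t x
    using Node.prems by (intro Node.IH[OF that]) auto
  ultimately show ?case by (simp cong: map_cong)
qed

lemma rooted_count_cong:
  assumes "\<And>u. u \<in> set (top_vertex t # anc) \<Longrightarrow> \<phi> u = \<psi> u"
  shows "rooted_count E A anc t \<phi> = rooted_count E A anc t \<psi>"
proof (cases t)
  case (Node v ts)
  have "fits E A anc v \<phi> = fits E A anc v \<psi>" using assms Node by (intro fits_cong) auto
  moreover have "tree_count E A (v # anc) t' \<phi> = tree_count E A (v # anc) t' \<psi>" for t'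
    using assms Node by (intro tree_count_cong) auto
  ultimately show ?thesis using Node by simp
qed

text \<open>The identity that saves a pass: if the root is adjacent to the ancestor
  \<open>p\<close>, an image outside the neighbourhood of the image of \<open>p\<close> contributes
  0, so the neighbours listed in the pass for \<open>p\<close> suffice.\<close>

lemma tree_count_paired:
  assumes "p \<in> set anc" "(p, top_vertex t) \<in> E" "finite A" "top_vertex t \<noteq> p" "snd ` A \<subseteq> fst ` A"
  shows "tree_count E A anc t \<phi> = (\<Sum>y | (\<phi> p, y) \<in> A. rooted_count E A anc t (\<phi>(top_vertex t := y)))"
  unfolding tree_count_eq_sum_rooted_count
proof (rule sum.mono_neutral_right)
  show "{y. (\<phi> p, y) \<in> A} \<subseteq> fst ` A" using assms(5) by force
  show "\<forall>y\<in>fst ` A - {y. (\<phi> p, y) \<in> A}. rooted_count E A anc t (\<phi>(top_vertex t := y)) = 0"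
    using assms(1,2,4) by (cases t) (fastforce simp: fits_def)
qed (use assms in auto)

section \<open>Bounds on the counts, used to exclude overflow\<close>

lemma prod_list_le_power:
  "(\<And>t. t \<in> set ts \<Longrightarrow> f t \<le> N ^ g t) \<Longrightarrow> (\<Prod>t\<leftarrow>ts. f t) \<le> (N :: nat) ^ (\<Sum>t\<leftarrow>ts. g t)"
  by (induction ts) (auto simp: power_add intro: mult_mono)

lemma length_preorder: "length (preorder (Node v ts)) = Suc (\<Sum>t\<leftarrow>ts. length (preorder t))"
  by (simp add: length_concat o_def)

lemma top_vertex_in_preorder [simp]: "top_vertex t \<in> set (preorder t)"
  by (cases t) simp

lemma tree_count_le: "card (fst ` A) \<le> N \<Longrightarrow> tree_count E A anc t \<phi> \<le> N ^ length (preorder t)"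
proof (induction t arbitrary: anc \<phi>)
  case (Node v ts)
  have "tree_count E A anc (Node v ts) \<phi> \<le> (\<Sum>x\<in>fst ` A. 1 * N ^ (\<Sum>t\<leftarrow>ts. length (preorder t)))"
    unfolding tree_count.simps using Node.IH[OF _ Node.prems] fits_le_1
    by (intro sum_mono mult_mono prod_list_le_power) auto
  also have "\<dots> \<le> N * N ^ (\<Sum>t\<leftarrow>ts. length (preorder t))"
    using Node.prems by simp
  finally show ?case by (simp only: length_preorder power_Suc)
qed

text \<open>With the image of the root fixed, one factor \<open>N\<close> less is needed than in
  \<open>tree_count_le\<close>; multiplying by \<open>N\<close> avoids a subtraction in the
  exponent.\<close>

lemma rooted_count_le:
  assumes "card (fst ` A) \<le> N"
  shows "N * rooted_count E A anc t \<phi> \<le> N ^ length (preorder t)"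
proof (cases t)
  case (Node v ts)
  have "rooted_count E A anc t \<phi> \<le> 1 * N ^ (\<Sum>t\<leftarrow>ts. length (preorder t))"
    unfolding Node rooted_count.simps using tree_count_le[OF assms] fits_le_1
    by (intro mult_mono prod_list_le_power) auto
  then show ?thesis using Node length_preorder[of v ts] by simp
qed

lemma sum_rooted_count_le:
  assumes "card (fst ` A) \<le> N" "card Y \<le> N"
  shows "(\<Sum>y\<in>Y. rooted_count E A anc t (\<phi> y)) \<le> N ^ length (preorder t)"
proof (cases "N = 0")
  case True
  \<comment> \<open>A cardinality of 0 leaves open an infinite \<open>Y\<close>, over which the sum
    is 0 by convention.\<close>
  then have "infinite Y \<or> Y = {}" using assms(2) by auto
  then show ?thesis by auto
next
  case False
  have "N * (\<Sum>y\<in>Y. rooted_count E A anc t (\<phi> y)) = (\<Sum>y\<in>Y. N * rooted_count E A anc t (\<phi> y))"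
    by (rule sum_distrib_left)
  also have "\<dots> \<le> (\<Sum>y\<in>Y. N ^ length (preorder t))"
    by (intro sum_mono rooted_count_le assms(1))
  also have "\<dots> \<le> N * N ^ length (preorder t)" using assms(2) by simp
  finally show ?thesis using False by simp
qed

section \<open>The counting program\<close>

text \<open>
  The memory cells belonging to a pattern vertex \<open>v\<close>. \<open>Img v\<close> is its current image, \<open>Alt v\<close> the
  second endpoint of the current edge of the pass for \<open>v\<close>, \<open>Cur v\<close> the image at the previous edge,
  \<open>Same v\<close> tells whether the two agree, \<open>Prd v\<close> is the contribution of the current image, and \<open>Res v\<close>
  accumulates the result of the subtree below \<open>v\<close>.
\<close>

abbreviation "Img v \<equiv> prod_encode (2, v)"
abbreviation "Alt v \<equiv> prod_encode (3, v)"
abbreviation "Flag v \<equiv> prod_encode (4, v)"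
abbreviation "Cur v \<equiv> prod_encode (5, v)"
abbreviation "Res v \<equiv> prod_encode (6, v)"
abbreviation "Prd v \<equiv> prod_encode (7, v)"
abbreviation "Same v \<equiv> prod_encode (8, v)"
abbreviation "Tmp v \<equiv> prod_encode (9, v)"
abbreviation "Aux v \<equiv> prod_encode (10, v)"

definition seqs :: "com list \<Rightarrow> com" where
  "seqs cs = foldr Seq cs Skip"

lemma seqs_simps [simp]: "seqs [] = Skip" "seqs (c # cs) = Seq c (seqs cs)"
  by (simp_all add: seqs_def)

definition check_arcs :: "nat list \<Rightarrow> nat \<Rightarrow> com" where
  "check_arcs us v = seqs (map (\<lambda>u. Seq (Let (Tmp v) (Arc (Img u) (Img v)))
     (Let (Prd v) (Tms (Prd v) (Tmp v)))) us)"

definition times_children :: "nat \<Rightarrow> nat rtree list \<Rightarrow> com" where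
  "times_children v ts = seqs (map (\<lambda>t. Let (Prd v) (Tms (Prd v) (Res (top_vertex t)))) ts)"

text \<open>The filter is evaluated while the program is generated: \<open>E\<close> and
  \<open>anc\<close> belong to the pattern, and only arcs demanded by it are queried.\<close>

definition combine :: "(nat \<times> nat) set \<Rightarrow> nat list \<Rightarrow> nat \<Rightarrow> nat rtree list \<Rightarrow> com" where
  "combine E anc v ts = Seq (Let (Prd v) (Cst 1))
     (Seq (check_arcs (filter (\<lambda>u. (u, v) \<in> E) anc) v) (times_children v ts))"

text \<open>
  The contribution of a fixed image \<open>x\<close> is only known after its last edge. The pass therefore keeps
  \<open>Res v\<close> correct for the edges read so far: while \<open>x\<close> stays the same, its old contribution is
  subtracted here and the updated one is added at the end of the loop body. As all cells start at 0,
  it does no harm that \<open>Cur v\<close> initially looks like the vertex 0.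
\<close>

definition prelude :: "nat \<Rightarrow> com" where
  "prelude v = seqs
    [Let (Tmp v) (Mns (Img v) (Cur v)), Let (Aux v) (Mns (Cur v) (Img v)),
     Let (Tmp v) (Pls (Tmp v) (Aux v)), Let (Same v) (Cst 1), Let (Same v) (Mns (Same v) (Tmp v)),
     Let (Prd v) (Tms (Prd v) (Same v)), Let (Res v) (Mns (Res v) (Prd v)), Let (Cur v) (Var (Img v))]"

text \<open>Decides whether \<open>v\<close> does without a pass. Such a vertex has no second
  endpoint to offer, which is why \<open>code\<close> hands \<open>None\<close> to its
  children.\<close>

definition paired :: "(nat \<times> nat) set \<Rightarrow> nat option \<Rightarrow> nat \<Rightarrow> bool" where
  "paired E po v \<longleftrightarrow> (\<exists>p. po = Some p \<and> (p, v) \<in> E)"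

text \<open>
  \<open>po\<close> is the parent if the parent runs a pass of its own, so that its second endpoint is available,
  and \<open>None\<close> otherwise.
\<close>

fun code :: "(nat \<times> nat) set \<Rightarrow> nat option \<Rightarrow> nat list \<Rightarrow> nat rtree \<Rightarrow> com" where
  "code E po anc (Node v ts) =
    (if paired E po v
     then Seq (Let (Res v) (Tms (Res v) (Same (the po)))) (Seq (Let (Img v) (Var (Alt (the po))))
       (Seq (seqs (map (\<lambda>t. code E None (v # anc) t) ts))
       (Seq (combine E anc v ts) (Let (Res v) (Pls (Res v) (Prd v))))))
     else Seq (Let (Res v) (Cst 0)) (Seq (Let (Prd v) (Cst 0)) (Seq (Let (Cur v) (Cst 0))
       (Seq (seqs (map (\<lambda>t. Let (Res (top_vertex t)) (Cst 0)) ts))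
       (Loop v (Img v) (Alt v) (Flag v) (Seq (prelude v)
         (Seq (seqs (map (\<lambda>t. code E (Some v) (v # anc) t) ts))
         (Seq (combine E anc v ts) (Let (Res v) (Pls (Res v) (Prd v)))))))))))"

section \<open>Correctness of the loop-free fragments and a rule for loops\<close>

lemma check_arcs_correct:
  assumes "1 < B" "\<forall>u\<in>set us. m (Img u) \<in> pverts (host R)" "m (Img v) \<in> pverts (host R)" "m (Prd v) \<le> 1"
  shows "safe R B (check_arcs us v) m
    \<and> sem R (check_arcs us v) m (Prd v)
        = m (Prd v) * of_bool (\<forall>u\<in>set us. (m (Img u), m (Img v)) \<in> parcs (host R))
    \<and> (\<forall>z. z \<noteq> Prd v \<longrightarrow> z \<noteq> Tmp v \<longrightarrow> sem R (check_arcs us v) m z = m z)"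
  using assms(2-)
proof (induction us arbitrary: m)
  case (Cons u us)
  let ?x = "of_bool ((m (Img u), m (Img v)) \<in> parcs (host R)) :: nat"
  define m' where "m' = m(Tmp v := ?x, Prd v := m (Prd v) * ?x)"
  have s: "sem R (check_arcs (u # us) v) m = sem R (check_arcs us v) m'"
    by (simp add: check_arcs_def of_bool_def m'_def)
  have f: "safe R B (check_arcs (u # us) v) m \<longleftrightarrow> safe R B (check_arcs us v) m'"
    using Cons.prems assms(1) by (auto simp: check_arcs_def of_bool_def m'_def)
  have "\<forall>u\<in>set us. m' (Img u) \<in> pverts (host R)" "m' (Img v) \<in> pverts (host R)" "m' (Prd v) \<le> 1"
    using Cons.prems by (auto simp: m'_def)
  note IH = Cons.IH[OF this]
  have "m' (Prd v) = m (Prd v) * ?x" "\<And>u. m' (Img u) = m (Img u)"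
    "\<And>z. z \<noteq> Prd v \<Longrightarrow> z \<noteq> Tmp v \<Longrightarrow> m' z = m z"
    by (simp_all add: m'_def)
  with IH show ?case unfolding s f by simp
qed (simp add: check_arcs_def)

text \<open>Every partial product must stay below \<open>B\<close>. For the induction,
  \<open>k\<close> records the exponent already spent in \<open>Prd v\<close>.\<close>

lemma times_children_correct:
  assumes "1 \<le> N" "\<forall>t\<in>set ts. top_vertex t \<noteq> v \<and> m (Res (top_vertex t)) \<le> N ^ g t"
    and "m (Prd v) \<le> N ^ k" "N ^ (k + (\<Sum>t\<leftarrow>ts. g t)) < B"
  shows "safe R B (times_children v ts) m
    \<and> sem R (times_children v ts) m (Prd v) = m (Prd v) * (\<Prod>t\<leftarrow>ts. m (Res (top_vertex t)))
    \<and> (\<forall>z. z \<noteq> Prd v \<longrightarrow> sem R (times_children v ts) m z = m z)"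
  using assms(2-)
proof (induction ts arbitrary: m k)
  case (Cons t ts)
  define m' where "m' = m(Prd v := m (Prd v) * m (Res (top_vertex t)))"
  have le: "m (Prd v) * m (Res (top_vertex t)) \<le> N ^ (k + g t)"
    unfolding power_add using Cons.prems by (intro mult_mono) auto
  also have "\<dots> \<le> N ^ (k + (\<Sum>t\<leftarrow>t # ts. g t))" using assms(1) by (intro power_increasing) auto
  finally have "m (Prd v) * m (Res (top_vertex t)) < B" using Cons.prems by simp
  then have s: "sem R (times_children v (t # ts)) m = sem R (times_children v ts) m'"
    and f: "safe R B (times_children v (t # ts)) m \<longleftrightarrow> safe R B (times_children v ts) m'"
    by (simp_all add: times_children_def m'_def)
  have "\<forall>t\<in>set ts. top_vertex t \<noteq> v \<and> m' (Res (top_vertex t)) \<le> N ^ g t" "m' (Prd v) \<le> N ^ (k + g t)"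
    "N ^ (k + g t + (\<Sum>t\<leftarrow>ts. g t)) < B"
    using Cons.prems le by (auto simp: add.assoc m'_def)
  note IH = Cons.IH[OF this]
  have "m' (Prd v) = m (Prd v) * m (Res (top_vertex t))" "\<And>u. m' (Res u) = m (Res u)"
    "\<And>z. z \<noteq> Prd v \<Longrightarrow> m' z = m z"
    by (simp_all add: m'_def)
  with IH show ?case unfolding s f by (simp add: mult.assoc)
qed (simp add: times_children_def)

lemma combine_correct:
  assumes "1 < N" "\<forall>u\<in>set (v # anc). m (Img u) \<in> pverts (host R)"
    and "\<forall>t\<in>set ts. top_vertex t \<noteq> v \<and> m (Res (top_vertex t)) \<le> N ^ g t" "N ^ Suc (\<Sum>t\<leftarrow>ts. g t) < B"
  shows "safe R B (combine E anc v ts) m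
    \<and> sem R (combine E anc v ts) m (Prd v)
       = fits E (parcs (host R)) anc v (\<lambda>u. m (Img u)) * (\<Prod>t\<leftarrow>ts. m (Res (top_vertex t)))
    \<and> (\<forall>z. z \<noteq> Prd v \<longrightarrow> z \<noteq> Tmp v \<longrightarrow> sem R (combine E anc v ts) m z = m z)"
proof -
  let ?us = "filter (\<lambda>u. (u, v) \<in> E) anc"
  define m1 where "m1 = m(Prd v := 1)"
  define m2 where "m2 = sem R (check_arcs ?us v) m1"
  have B: "1 < B"
  proof -
    have "1 \<le> N ^ Suc (\<Sum>t\<leftarrow>ts. g t)" using assms(1) by (intro one_le_power) simp
    then show ?thesis using assms(4) by linarith
  qed
  have "\<forall>u\<in>set ?us. m1 (Img u) \<in> pverts (host R)" "m1 (Img v) \<in> pverts (host R)" "m1 (Prd v) \<le> 1"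
    using assms(2) by (auto simp: m1_def)
  note 1 = check_arcs_correct[OF B this, folded m2_def]
  have c: "m2 (Prd v) = fits E (parcs (host R)) anc v (\<lambda>u. m (Img u))"
    using 1 by (auto simp: fits_def m1_def)
  have r: "m2 (Res (top_vertex t)) = m (Res (top_vertex t))" if "t \<in> set ts" for t
    using 1 that by (auto simp: m1_def)
  have "\<forall>t\<in>set ts. top_vertex t \<noteq> v \<and> m2 (Res (top_vertex t)) \<le> N ^ g t" using r assms(3) by simp
  moreover have "m2 (Prd v) \<le> N ^ 1" using c assms(1) fits_le_1[of E _ anc v] by (metis le_trans less_imp_le power_one_right)
  ultimately have 2: "safe R B (times_children v ts) m2
    \<and> sem R (times_children v ts) m2 (Prd v) = m2 (Prd v) * (\<Prod>t\<leftarrow>ts. m2 (Res (top_vertex t)))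
    \<and> (\<forall>z. z \<noteq> Prd v \<longrightarrow> sem R (times_children v ts) m2 z = m2 z)"
    using assms(1,4) by (intro times_children_correct[where N = N and g = g and k = 1]) auto
  have s: "sem R (combine E anc v ts) m = sem R (times_children v ts) m2"
    by (simp add: combine_def m2_def m1_def)
  have "safe R B (combine E anc v ts) m"
    using 1 2 B unfolding combine_def safe.simps sem.simps val.simps m1_def[symmetric] m2_def[symmetric]
    by simp
  moreover have "(\<Prod>t\<leftarrow>ts. m2 (Res (top_vertex t))) = (\<Prod>t\<leftarrow>ts. m (Res (top_vertex t)))"
    using r by (simp cong: map_cong)
  moreover have "m2 z = m z" if "z \<noteq> Prd v" "z \<noteq> Tmp v" for z using 1 that by (simp add: m1_def)
  ultimately show ?thesis unfolding s using 2 c by simp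
qed

text \<open>The invariant is indexed by the list of arcs already read, not by their number, so that
  a step can exploit that the sequence is sorted and distinct.\<close>

lemma loop_rule:
  assumes "I [] m"
    and step: "\<And>es x y es' m. edge_seq R = es @ (x, y) # es' \<Longrightarrow> I es m \<Longrightarrow>
      x < B \<and> y < B \<and> safe R B c (enter a b f (x, y) m) \<and> I (es @ [(x, y)]) (sem R c (enter a b f (x, y) m))"
  shows "safe R B (Loop j a b f c) m \<and> (\<exists>m'. I (edge_seq R) m' \<and> sem R (Loop j a b f c) m = m'(f := 0))"
proof -
  let ?m = "\<lambda>i. fold (\<lambda>e m. sem R c (enter a b f e m)) (take i (edge_seq R)) m"
  have split: "edge_seq R = take i (edge_seq R) @ (fst (edge_seq R ! i), snd (edge_seq R ! i)) # drop (Suc i) (edge_seq R)"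
    if "i < length (edge_seq R)" for i
    unfolding prod.collapse using that by (rule id_take_nth_drop)
  have I: "I (take i (edge_seq R)) (?m i)" if "i \<le> length (edge_seq R)" for i
    using that
  proof (induction i)
    case (Suc i)
    then show ?case using step[OF split[of i], of "?m i"] by (simp add: take_Suc_conv_app_nth)
  qed (use assms in simp)
  have "safe R B (Loop j a b f c) m"
    unfolding safe.simps
  proof (intro allI impI)
    fix i assume i: "i < length (edge_seq R)"
    show "fst (edge_seq R ! i) < B \<and> snd (edge_seq R ! i) < B \<and> safe R B c (enter a b f (edge_seq R ! i) (?m i))"
      using step[OF split[OF i] I] i by simp
  qed
  moreover have "I (edge_seq R) (?m (length (edge_seq R)))"
    using I[of "length (edge_seq R)"] by simp
  moreover have "sem R (Loop j a b f c) m = (?m (length (edge_seq R)))(f := 0)"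
    by simp
  ultimately show ?thesis by blast
qed

text \<open>Equality test in a language without comparisons: one of the truncated differences is 0,
  so their sum is the distance.\<close>

lemma one_minus_dist: "Suc 0 - (a - b + (b - a)) = of_bool (a = b)" for a b :: nat
  by auto

lemma prelude_correct:
  assumes "m (Img v) < N" "m (Cur v) < N" "2 * N \<le> B" "1 < B" "m (Res v) < B" "m (Prd v) < B"
  shows "safe R B (prelude v) m"
    and "sem R (prelude v) m (Same v) = of_bool (m (Img v) = m (Cur v))"
    and "sem R (prelude v) m (Res v) = m (Res v) - m (Prd v) * of_bool (m (Img v) = m (Cur v))"
    and "sem R (prelude v) m (Cur v) = m (Img v)"
    and "sem R (prelude v) m (Img v) = m (Img v)"
    and "sem R (prelude v) m (Alt v) = m (Alt v)"
    and "u \<noteq> v \<Longrightarrow> sem R (prelude v) m (prod_encode (k, u)) = m (prod_encode (k, u))"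
  using assms by (auto simp: prelude_def one_minus_dist)

section \<open>Correctness of the program for a tree\<close>

locale host_env =
  fixes R :: host_rep and N B :: nat and E :: "(nat \<times> nat) set"
  assumes host: "pair_graph (host R)"
    and edges: "set (edge_seq R) = parcs (host R)" "distinct (edge_seq R)" "sorted (map fst (edge_seq R))"
    and verts_less: "\<And>x. x \<in> pverts (host R) \<Longrightarrow> x < N" and N: "2 \<le> N"
begin

abbreviation "A \<equiv> parcs (host R)"

lemma finite_A: "finite A"
  using edges(1) by (metis List.finite_set)

lemma A_verts: "fst ` A \<subseteq> pverts (host R)" "snd ` A \<subseteq> fst ` A"
proof -
  interpret pair_graph "host R" by (rule host)
  show "fst ` A \<subseteq> pverts (host R)" by (auto dest: in_arcsD1)
  show "snd ` A \<subseteq> fst ` A" using arcs_symmetric by force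
qed

lemma A_less: "x \<in> fst ` A \<Longrightarrow> x < N"
  using A_verts verts_less by blast

text \<open>Labels are natural numbers below \<open>N\<close>, so the bound on labels also bounds
  the number of images.\<close>

lemma card_A: "Y \<subseteq> fst ` A \<Longrightarrow> card Y \<le> N"
  using A_less card_mono[of "{..<N}" Y] by (auto simp: subset_eq)

lemma tree_count_A_le: "tree_count E A anc t \<phi> \<le> N ^ length (preorder t)"
  by (intro tree_count_le card_A order_refl)

text \<open>The spare factor \<open>N\<close> in the size bound leaves room for adding a new
  contribution to an accumulator. The last conjunct is there because a paired root reads its
  accumulator instead of initialising it.\<close>

definition ready :: "nat option \<Rightarrow> nat list \<Rightarrow> nat rtree \<Rightarrow> (nat \<Rightarrow> nat) \<Rightarrow> bool" where
  "ready po anc t m \<longleftrightarrow> distinct (anc @ preorder t) \<and> N ^ Suc (length (preorder t)) < B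
     \<and> (\<forall>u\<in>set anc. m (Img u) \<in> fst ` A)
     \<and> (\<forall>p. po = Some p \<longrightarrow> p \<in> set anc)
     \<and> (\<forall>p. po = Some p \<and> (p, top_vertex t) \<in> E \<longrightarrow>
          m (Alt p) \<in> fst ` A \<and> m (Same p) \<le> 1 \<and> m (Res (top_vertex t)) \<le> N ^ length (preorder t))"

text \<open>For a paired root, \<open>code\<close> performs a single step of the summation in
  \<open>tree_count_paired\<close>: it adds one neighbour to the accumulator, which is cleared first
  if the parent has changed its image.\<close>

definition outcome :: "nat option \<Rightarrow> nat list \<Rightarrow> nat rtree \<Rightarrow> (nat \<Rightarrow> nat) \<Rightarrow> nat" where
  "outcome po anc t m =
    (if paired E po (top_vertex t)
     then m (Res (top_vertex t)) * m (Same (the po))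
       + rooted_count E A anc t ((\<lambda>u. m (Img u))(top_vertex t := m (Alt (the po))))
     else tree_count E A anc t (\<lambda>u. m (Img u)))"

text \<open>As \<open>prod_encode\<close> is onto, all cells are covered. Grouping them by owner
  reduces non-interference to disjointness of vertex sets.\<close>

definition agree_off :: "nat set \<Rightarrow> (nat \<Rightarrow> nat) \<Rightarrow> (nat \<Rightarrow> nat) \<Rightarrow> bool" where
  "agree_off S m m' \<longleftrightarrow> (\<forall>k u. u \<notin> S \<longrightarrow> m' (prod_encode (k, u)) = m (prod_encode (k, u)))"

lemma agree_off_trans: "agree_off S m m' \<Longrightarrow> agree_off S m' m'' \<Longrightarrow> agree_off S m m''"
  by (simp add: agree_off_def)

lemma agree_off_mono: "agree_off S m m' \<Longrightarrow> S \<subseteq> S' \<Longrightarrow> agree_off S' m m'"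
  by (auto simp: agree_off_def)

lemma ready_agree:
  assumes "ready po anc t m" "agree_off S m m'" "S \<inter> set (top_vertex t # anc) = {}"
  shows "ready po anc t m'"
proof -
  have "m' (prod_encode (k, u)) = m (prod_encode (k, u))" if "u \<in> set (top_vertex t # anc)" for k u
    using assms(2,3) that by (auto simp: agree_off_def)
  then show ?thesis using assms(1) by (auto simp: ready_def)
qed

lemma outcome_agree:
  assumes "ready po anc t m" "agree_off S m m'" "S \<inter> set (top_vertex t # anc) = {}"
  shows "outcome po anc t m' = outcome po anc t m"
proof -
  have eq: "m' (prod_encode (k, u)) = m (prod_encode (k, u))" if "u \<in> set (top_vertex t # anc)" for k u
    using assms(2,3) that by (auto simp: agree_off_def)
  show ?thesis
  proof (cases "paired E po (top_vertex t)")
    case True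
    then have p: "the po \<in> set anc" using assms(1) by (auto simp: ready_def paired_def)
    have "rooted_count E A anc t ((\<lambda>u. m' (Img u))(top_vertex t := m' (Alt (the po))))
      = rooted_count E A anc t ((\<lambda>u. m (Img u))(top_vertex t := m (Alt (the po))))"
      using eq p by (intro rooted_count_cong) auto
    then show ?thesis using True eq p by (simp add: outcome_def)
  next
    case False
    have "tree_count E A anc t (\<lambda>u. m' (Img u)) = tree_count E A anc t (\<lambda>u. m (Img u))"
      using eq by (intro tree_count_cong) auto
    then show ?thesis using False by (simp add: outcome_def)
  qed
qed

definition good :: "nat option \<Rightarrow> nat list \<Rightarrow> nat rtree \<Rightarrow> (nat \<Rightarrow> nat) \<Rightarrow> bool" where
  "good po anc t m \<longleftrightarrow> safe R B (code E po anc t) m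
     \<and> agree_off (set (preorder t)) m (sem R (code E po anc t) m)
     \<and> sem R (code E po anc t) m (Res (top_vertex t)) = outcome po anc t m"

text \<open>Siblings do not interfere: each writes only cells of its own subtree, whereas
  \<open>ready\<close> and \<open>outcome\<close> of another one depend on cells of its root and of
  ancestors.\<close>

lemma children_correct:
  assumes "\<And>t m. t \<in> set ts \<Longrightarrow> ready po anc t m \<Longrightarrow> good po anc t m"
    and "\<And>t. t \<in> set ts \<Longrightarrow> ready po anc t m"
    and "distinct (concat (map preorder ts))" "set anc \<inter> set (concat (map preorder ts)) = {}"
  shows "safe R B (seqs (map (code E po anc) ts)) m
    \<and> agree_off (set (concat (map preorder ts))) m (sem R (seqs (map (code E po anc) ts)) m)
    \<and> (\<forall>t\<in>set ts. sem R (seqs (map (code E po anc) ts)) m (Res (top_vertex t)) = outcome po anc t m)"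
  using assms
proof (induction ts arbitrary: m)
  case Nil
  then show ?case by (simp add: agree_off_def)
next
  case (Cons t ts)
  define m' where "m' = sem R (code E po anc t) m"
  have g: "good po anc t m" using Cons.prems by simp
  have ag: "agree_off (set (preorder t)) m m'" using g by (simp add: good_def m'_def)
  have disj: "set (preorder t) \<inter> set (top_vertex t' # anc) = {}" if "t' \<in> set ts" for t'
    using Cons.prems(3,4) that by (auto dest!: bspec top_vertex_in_preorder[THEN subsetD[rotated]] simp: disjoint_iff)
  have rd: "ready po anc t' m'" if "t' \<in> set ts" for t'
    using ready_agree[OF Cons.prems(2) ag disj] that by simp
  have oc: "outcome po anc t' m' = outcome po anc t' m" if "t' \<in> set ts" for t'
    using outcome_agree[OF Cons.prems(2) ag disj] that by simp
  have IH: "safe R B (seqs (map (code E po anc) ts)) m'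
    \<and> agree_off (set (concat (map preorder ts))) m' (sem R (seqs (map (code E po anc) ts)) m')
    \<and> (\<forall>t\<in>set ts. sem R (seqs (map (code E po anc) ts)) m' (Res (top_vertex t)) = outcome po anc t m')"
    using Cons.prems rd by (intro Cons.IH) auto
  have "top_vertex t \<notin> set (concat (map preorder ts))"
    using Cons.prems(3) top_vertex_in_preorder[of t] unfolding list.map concat.simps distinct_append by blast
  then have "sem R (seqs (map (code E po anc) ts)) m' (Res (top_vertex t)) = m' (Res (top_vertex t))"
    using IH unfolding agree_off_def by blast
  moreover have "m' (Res (top_vertex t)) = outcome po anc t m" using g by (simp add: good_def m'_def)
  moreover have "agree_off (set (concat (map preorder (t # ts)))) m (sem R (seqs (map (code E po anc) ts)) m')"
    by (rule agree_off_trans[OF agree_off_mono[OF ag] agree_off_mono[OF IH[THEN conjunct2, THEN conjunct1]]]) auto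
  ultimately show ?case using IH oc g by (simp add: good_def m'_def)
qed

lemma zero_children:
  "safe R B (seqs (map (\<lambda>t. Let (Res (top_vertex t)) (Cst 0)) ts)) m \<longleftrightarrow> 0 < B \<or> ts = []"
  "sem R (seqs (map (\<lambda>t. Let (Res (top_vertex t)) (Cst 0)) ts)) m
    = (\<lambda>z. if z \<in> (\<lambda>t. Res (top_vertex t)) ` set ts then 0 else m z)"
  by (induction ts arbitrary: m) (auto simp: fun_eq_iff)

lemma good_paired:
  assumes IH: "\<And>t po anc m. t \<in> set ts \<Longrightarrow> ready po anc t m \<Longrightarrow> good po anc t m"
    and rd: "ready po anc (Node v ts) m" and p: "po = Some p" "(p, v) \<in> E"
  shows "good po anc (Node v ts) m"
proof -
  let ?n = "\<lambda>t. length (preorder t)"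
  have dist: "distinct (anc @ v # concat (map preorder ts))" and big: "N ^ Suc (Suc (\<Sum>t\<leftarrow>ts. ?n t)) < B"
    and img: "\<And>u. u \<in> set anc \<Longrightarrow> m (Img u) \<in> fst ` A" and pa: "p \<in> set anc"
    and alt: "m (Alt p) \<in> fst ` A" "m (Same p) \<le> 1" "m (Res v) \<le> N ^ Suc (\<Sum>t\<leftarrow>ts. ?n t)"
    using rd p unfolding ready_def length_preorder by auto
  define m1 where "m1 = m(Res v := m (Res v) * m (Same p), Img v := m (Alt p))"
  define m2 where "m2 = sem R (seqs (map (code E None (v # anc)) ts)) m1"
  define m3 where "m3 = sem R (combine E anc v ts) m2"
  have pv: "p \<noteq> v" using dist pa by auto
  have rdt: "ready None (v # anc) t m1" if "t \<in> set ts" for t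
  proof -
    have "?n t \<le> (\<Sum>t\<leftarrow>ts. ?n t)" using that by (simp add: member_le_sum_list)
    then have "N ^ Suc (?n t) \<le> N ^ Suc (Suc (\<Sum>t\<leftarrow>ts. ?n t))" using N by (intro power_increasing) auto
    then have "N ^ Suc (?n t) < B" using big by linarith
    moreover have "distinct (preorder t)" using dist that by (simp add: distinct_concat_iff)
    ultimately show ?thesis using dist that img alt(1) by (auto simp: ready_def m1_def)
  qed
  have ch: "safe R B (seqs (map (code E None (v # anc)) ts)) m1
    \<and> agree_off (set (concat (map preorder ts))) m1 m2
    \<and> (\<forall>t\<in>set ts. m2 (Res (top_vertex t)) = outcome None (v # anc) t m1)"
    unfolding m2_def using IH rdt dist by (intro children_correct) auto
  have m2v: "m2 (prod_encode (k, u)) = m1 (prod_encode (k, u))" if "u \<in> set (v # anc)" for k u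
  proof -
    have "u \<notin> set (concat (map preorder ts))" using that dist by auto
    then show ?thesis using ch unfolding agree_off_def by blast
  qed
  have res: "m2 (Res (top_vertex t)) = tree_count E A (v # anc) t (\<lambda>u. m1 (Img u))" if "t \<in> set ts" for t
    using ch that by (simp add: outcome_def paired_def)
  have topv: "top_vertex t \<noteq> v" if "t \<in> set ts" for t
    using dist that top_vertex_in_preorder[of t] by auto
  have comb: "safe R B (combine E anc v ts) m2
    \<and> m3 (Prd v) = fits E A anc v (\<lambda>u. m2 (Img u)) * (\<Prod>t\<leftarrow>ts. m2 (Res (top_vertex t)))
    \<and> (\<forall>z. z \<noteq> Prd v \<longrightarrow> z \<noteq> Tmp v \<longrightarrow> m3 z = m2 z)"
    unfolding m3_def
  proof (rule combine_correct[where N = N and g = ?n])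
    show "\<forall>u\<in>set (v # anc). m2 (Img u) \<in> pverts (host R)"
      using m2v img alt(1) A_verts(1) by (auto simp: m1_def)
    show "\<forall>t\<in>set ts. top_vertex t \<noteq> v \<and> m2 (Res (top_vertex t)) \<le> N ^ ?n t"
      using topv res tree_count_A_le by simp
    have "N ^ Suc (\<Sum>t\<leftarrow>ts. ?n t) \<le> N ^ Suc (Suc (\<Sum>t\<leftarrow>ts. ?n t))" using N by (intro power_increasing) auto
    then show "N ^ Suc (\<Sum>t\<leftarrow>ts. ?n t) < B" using big by linarith
  qed (use N in simp)
  have im: "(\<lambda>u. m1 (Img u)) = (\<lambda>u. m (Img u))(v := m (Alt p))" by (auto simp: m1_def)
  have fits: "fits E A anc v (\<lambda>u. m2 (Img u)) = fits E A anc v (\<lambda>u. m1 (Img u))"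
    using m2v by (intro fits_cong) simp
  have prd: "m3 (Prd v) = rooted_count E A anc (Node v ts) ((\<lambda>u. m (Img u))(v := m (Alt p)))"
    using comb fits res unfolding rooted_count.simps im by (simp cong: map_cong)
  have m3r: "m3 (Res v) = m (Res v) * m (Same p)" using comb m2v by (simp add: m1_def)
  \<comment> \<open>Old accumulator and new contribution obey the same bound;
    \<open>2 \<le> N\<close> lets the spare factor absorb their sum.\<close>
  have le: "m (Res v) * m (Same p) \<le> N ^ Suc (\<Sum>t\<leftarrow>ts. ?n t)"
    using alt(2,3) mult_le_mono[of "m (Res v)" _ "m (Same p)" 1] by simp
  have le': "N * m3 (Prd v) \<le> N ^ Suc (\<Sum>t\<leftarrow>ts. ?n t)"
    unfolding prd length_preorder[of v, symmetric] by (intro rooted_count_le card_A order_refl)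
  have "m3 (Prd v) \<le> N * m3 (Prd v)" using N by simp
  then have "m3 (Res v) + m3 (Prd v) \<le> 2 * N ^ Suc (\<Sum>t\<leftarrow>ts. ?n t)" using le le' m3r by linarith
  also have "\<dots> \<le> N * N ^ Suc (\<Sum>t\<leftarrow>ts. ?n t)" using N by (intro mult_right_mono) auto
  finally have bd: "m3 (Res v) + m3 (Prd v) < B" using big by simp
  have "N ^ Suc (\<Sum>t\<leftarrow>ts. ?n t) \<le> N ^ Suc (Suc (\<Sum>t\<leftarrow>ts. ?n t))" using N by (intro power_increasing) auto
  then have bd1: "m (Res v) * m (Same p) < B" using le big by linarith
  have "N ^ 1 \<le> N ^ Suc (Suc (\<Sum>t\<leftarrow>ts. ?n t))" using N by (intro power_increasing) auto
  then have bd2: "m (Alt p) < B" using A_less[OF alt(1)] big unfolding power_one_right by linarith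
  have pr: "paired E po v" "the po = p" using p by (auto simp: paired_def)
  have cd: "code E po anc (Node v ts) = Seq (Let (Res v) (Tms (Res v) (Same p))) (Seq (Let (Img v) (Var (Alt p)))
       (Seq (seqs (map (code E None (v # anc)) ts))
       (Seq (combine E anc v ts) (Let (Res v) (Pls (Res v) (Prd v))))))"
    using pr by simp
  have m1': "(m(Res v := m (Res v) * m (Same p)))(Img v := (m(Res v := m (Res v) * m (Same p))) (Alt p)) = m1"
    by (simp add: m1_def)
  have s: "sem R (code E po anc (Node v ts)) m = m3(Res v := m3 (Res v) + m3 (Prd v))"
    unfolding cd sem.simps val.simps m1' m2_def[symmetric] m3_def[symmetric] ..
  have f: "safe R B (code E po anc (Node v ts)) m"
    unfolding cd safe.simps sem.simps val.simps m1' m2_def[symmetric] m3_def[symmetric]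
    using bd bd1 bd2 ch comb by simp
  have "agree_off (set (preorder (Node v ts))) m (m3(Res v := m3 (Res v) + m3 (Prd v)))"
    unfolding agree_off_def
  proof (intro allI impI)
    fix k u assume u: "u \<notin> set (preorder (Node v ts))"
    then have "m3 (prod_encode (k, u)) = m2 (prod_encode (k, u))" using comb by simp
    also have "\<dots> = m1 (prod_encode (k, u))" using ch u by (simp add: agree_off_def)
    also have "\<dots> = m (prod_encode (k, u))" using u by (simp add: m1_def)
    finally show "(m3(Res v := m3 (Res v) + m3 (Prd v))) (prod_encode (k, u)) = m (prod_encode (k, u))"
      using u by simp
  qed
  then show ?thesis unfolding good_def s using f prd m3r pr by (simp add: outcome_def)
qed

text \<open>In mid-pass an adjacent child knows only the arcs \<open>es\<close> read so far. For the
  complete sequence the value becomes \<open>tree_count\<close> by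
  \<open>tree_count_paired\<close>.\<close>

definition child_sum :: "(nat \<times> nat) list \<Rightarrow> nat list \<Rightarrow> nat \<Rightarrow> (nat \<Rightarrow> nat) \<Rightarrow> nat \<Rightarrow> nat rtree \<Rightarrow> nat" where
  "child_sum es anc v \<phi> x t =
    (\<Sum>y | (x, y) \<in> set es. rooted_count E A (v # anc) t (\<phi>(v := x, top_vertex t := y)))"

definition child_val :: "(nat \<times> nat) list \<Rightarrow> nat list \<Rightarrow> nat \<Rightarrow> (nat \<Rightarrow> nat) \<Rightarrow> nat \<Rightarrow> nat rtree \<Rightarrow> nat" where
  "child_val es anc v \<phi> x t =
    (if (v, top_vertex t) \<in> E then child_sum es anc v \<phi> x t else tree_count E A (v # anc) t (\<phi>(v := x)))"

definition group_val :: "(nat \<times> nat) list \<Rightarrow> nat list \<Rightarrow> nat \<Rightarrow> nat rtree list \<Rightarrow> (nat \<Rightarrow> nat) \<Rightarrow> nat \<Rightarrow> nat" where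
  "group_val es anc v ts \<phi> x =
    fits E A anc v (\<phi>(v := x)) * (\<Prod>t\<leftarrow>ts. child_val es anc v \<phi> x t)"

text \<open>Every source met so far is counted as if \<open>es\<close> were all arcs. Only the last
  one can still gain arcs, and \<open>Prd v\<close> keeps its share so that it can be withdrawn. On
  the empty prefix these values are 0, which makes a chance agreement of \<open>Cur v\<close> with
  the first source harmless.\<close>

definition loop_inv ::
  "(nat \<Rightarrow> nat) \<Rightarrow> nat list \<Rightarrow> nat \<Rightarrow> nat rtree list \<Rightarrow> (nat \<times> nat) list \<Rightarrow> (nat \<Rightarrow> nat) \<Rightarrow> bool" where
  "loop_inv m\<^sub>0 anc v ts es m \<longleftrightarrow>
     agree_off (set (preorder (Node v ts))) m\<^sub>0 m
     \<and> m (Res v) = (\<Sum>x\<in>fst ` set es. group_val es anc v ts (\<lambda>u. m\<^sub>0 (Img u)) x)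
     \<and> m (Cur v) = (if es = [] then 0 else fst (last es))
     \<and> m (Prd v) = (if es = [] then 0 else group_val es anc v ts (\<lambda>u. m\<^sub>0 (Img u)) (m (Cur v)))
     \<and> (\<forall>t\<in>set ts. (v, top_vertex t) \<in> E \<longrightarrow>
          m (Res (top_vertex t)) = child_sum es anc v (\<lambda>u. m\<^sub>0 (Img u)) (m (Cur v)) t)"

lemma child_sum_le:
  assumes "set es \<subseteq> A"
  shows "child_sum es anc v \<phi> x t \<le> N ^ length (preorder t)"
  unfolding child_sum_def
proof (rule sum_rooted_count_le)
  show "card {y. (x, y) \<in> set es} \<le> N" using assms A_verts(2) by (intro card_A) force
qed (rule card_A, rule order_refl)

lemma child_val_le: "set es \<subseteq> A \<Longrightarrow> child_val es anc v \<phi> x t \<le> N ^ length (preorder t)"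
  unfolding child_val_def using child_sum_le tree_count_A_le by simp

lemma group_val_le:
  assumes "set es \<subseteq> A"
  shows "group_val es anc v ts \<phi> x \<le> N ^ (\<Sum>t\<leftarrow>ts. length (preorder t))"
proof -
  have "group_val es anc v ts \<phi> x \<le> 1 * N ^ (\<Sum>t\<leftarrow>ts. length (preorder t))"
    unfolding group_val_def using assms
    by (intro mult_le_mono fits_le_1 prod_list_le_power child_val_le)
  then show ?thesis by simp
qed

lemma sum_group_val_le:
  assumes "set es \<subseteq> A" "X \<subseteq> fst ` A"
  shows "(\<Sum>x\<in>X. group_val es anc v ts \<phi> x) \<le> N ^ Suc (\<Sum>t\<leftarrow>ts. length (preorder t))"
proof -
  have "(\<Sum>x\<in>X. group_val es anc v ts \<phi> x) \<le> (\<Sum>x\<in>X. N ^ (\<Sum>t\<leftarrow>ts. length (preorder t)))"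
    by (intro sum_mono group_val_le assms)
  also have "\<dots> \<le> N * N ^ (\<Sum>t\<leftarrow>ts. length (preorder t))" using card_A[OF assms(2)] by simp
  finally show ?thesis by simp
qed

lemma group_val_snoc_other:
  assumes "x' \<noteq> x"
  shows "group_val (es @ [(x, y)]) anc v ts \<phi> x' = group_val es anc v ts \<phi> x'"
proof -
  have "{y'. (x', y') \<in> set (es @ [(x, y)])} = {y'. (x', y') \<in> set es}" using assms by auto
  then have "child_val (es @ [(x, y)]) anc v \<phi> x' t = child_val es anc v \<phi> x' t" for t
    by (simp add: child_val_def child_sum_def)
  then show ?thesis by (simp add: group_val_def)
qed

text \<open>Here the order of the iteration enters: arcs with the same source are consecutive, so a
  source that differs from the last one is entirely new.\<close>

lemma fst_notin_prefix:
  assumes es: "edge_seq R = es @ (x, y) # es'" and "es \<noteq> [] \<Longrightarrow> fst (last es) \<noteq> x"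
  shows "x \<notin> fst ` set es"
proof
  assume x: "x \<in> fst ` set es"
  then obtain es0 e where e: "es = es0 @ [e]" by (cases es rule: rev_cases) auto
  have "\<forall>z\<in>fst ` set es0. z \<le> fst e" "fst e \<le> x"
    using edges(3) unfolding es e by (auto simp: sorted_append)
  then have "x = fst e" using x unfolding e by auto
  then show False using assms(2) e by simp
qed

text \<open>The recurrence carried out by a paired child: within a run of equal sources the sum
  continues, otherwise it restarts from 0. Distinctness of the sequence ensures that
  \<open>y\<close> is a new summand.\<close>

lemma child_sum_snoc:
  assumes es: "edge_seq R = es @ (x, y) # es'" and cur: "c = (if es = [] then 0 else fst (last es))"
  shows "child_sum (es @ [(x, y)]) anc v \<phi> x t
    = child_sum es anc v \<phi> c t * of_bool (x = c) + rooted_count E A (v # anc) t (\<phi>(v := x, top_vertex t := y))"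
proof -
  have new: "(x, y) \<notin> set es" using edges(2) es by auto
  have eq: "{y'. (x, y') \<in> set (es @ [(x, y)])} = insert y {y'. (x, y') \<in> set es}" by auto
  have fin: "finite {y'. (x, y') \<in> set es}"
    by (rule finite_subset[of _ "snd ` set es"]) force+
  have snoc: "child_sum (es @ [(x, y)]) anc v \<phi> x t
    = child_sum es anc v \<phi> x t + rooted_count E A (v # anc) t (\<phi>(v := x, top_vertex t := y))"
    unfolding child_sum_def eq using new fin by simp
  show ?thesis
  proof (cases "x = c")
    case False
    have "x \<notin> fst ` set es" by (rule fst_notin_prefix[OF es]) (use False cur in auto)
    then have "{y'. (x, y') \<in> set es} = {}" by force
    then have "child_sum es anc v \<phi> x t = 0" by (simp add: child_sum_def)
    then show ?thesis using snoc False by simp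
  qed (use snoc in simp)
qed

text \<open>The memories \<open>m1\<close> to \<open>m4\<close> are those after fetching the arc,
  the prelude, the children and the recombination.\<close>

lemma loop_step:
  assumes IH: "\<And>t po anc m. t \<in> set ts \<Longrightarrow> ready po anc t m \<Longrightarrow> good po anc t m"
    and rd: "ready po anc (Node v ts) m\<^sub>0"
    and es: "edge_seq R = es @ (x, y) # es'"
    and inv: "loop_inv m\<^sub>0 anc v ts es m"
  defines "body \<equiv> Seq (prelude v) (Seq (seqs (map (code E (Some v) (v # anc)) ts))
         (Seq (combine E anc v ts) (Let (Res v) (Pls (Res v) (Prd v)))))"
  shows "x < B \<and> y < B \<and> safe R B body (enter (Img v) (Alt v) (Flag v) (x, y) m)
    \<and> loop_inv m\<^sub>0 anc v ts (es @ [(x, y)]) (sem R body (enter (Img v) (Alt v) (Flag v) (x, y) m))"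
proof -
  let ?n = "\<lambda>t. length (preorder t)" and ?es = "es @ [(x, y)]" and ?\<phi> = "\<lambda>u. m\<^sub>0 (Img u)"
  let ?g = "\<lambda>es x. group_val es anc v ts ?\<phi> x"
  have dist: "distinct (anc @ v # concat (map preorder ts))" and big: "N ^ Suc (Suc (\<Sum>t\<leftarrow>ts. ?n t)) < B"
    and img: "\<And>u. u \<in> set anc \<Longrightarrow> m\<^sub>0 (Img u) \<in> fst ` A"
    using rd unfolding ready_def length_preorder by auto
  have sub: "set ?es \<subseteq> A" "set es \<subseteq> A" "(x, y) \<in> A" using edges(1) es by auto
  have xA: "x \<in> fst ` A" and yA: "y \<in> fst ` A" using sub(3) A_verts(2) by force+
  have i: "agree_off (set (preorder (Node v ts))) m\<^sub>0 m"
     "m (Res v) = (\<Sum>x\<in>fst ` set es. ?g es x)"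
     "m (Cur v) = (if es = [] then 0 else fst (last es))"
     "m (Prd v) = (if es = [] then 0 else ?g es (m (Cur v)))"
     "\<And>t. t \<in> set ts \<Longrightarrow> (v, top_vertex t) \<in> E \<Longrightarrow> m (Res (top_vertex t)) = child_sum es anc v ?\<phi> (m (Cur v)) t"
    using inv unfolding loop_inv_def by blast+
  have curN: "m (Cur v) < N"
  proof (cases "es = []")
    case False
    then have "last es \<in> A" using sub by auto
    then show ?thesis using i(3) False A_less by auto
  qed (use i(3) N in simp)
  have p1: "N ^ Suc (\<Sum>t\<leftarrow>ts. ?n t) \<le> N ^ Suc (Suc (\<Sum>t\<leftarrow>ts. ?n t))"
    "N ^ 2 \<le> N ^ Suc (Suc (\<Sum>t\<leftarrow>ts. ?n t))" "N ^ (\<Sum>t\<leftarrow>ts. ?n t) \<le> N ^ Suc (Suc (\<Sum>t\<leftarrow>ts. ?n t))"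
    using N by (intro power_increasing; simp)+
  \<comment> \<open>The prelude adds two differences below \<open>N\<close>, hence needs room for
    \<open>2 * N\<close>.\<close>
  have NN: "2 * N \<le> N ^ 2" using N by (simp add: power2_eq_square)
  have B2: "2 * N \<le> B" "1 < B" using NN p1(2) big N by linarith+
  have xyB: "x < B" "y < B" using A_less[OF xA] A_less[OF yA] B2 by linarith+
  have resle: "m (Res v) < B"
    using sum_group_val_le[OF sub(2) image_mono[OF sub(2)], of anc v ts ?\<phi>] i(2) p1(1) big
    by linarith
  have "m (Prd v) \<le> ?g es (m (Cur v))" using i(4) by simp
  then have prdle: "m (Prd v) < B"
    using group_val_le[OF sub(2), of anc v ts ?\<phi> "m (Cur v)"] p1(3) big by linarith
  define m1 where "m1 = enter (Img v) (Alt v) (Flag v) (x, y) m"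
  have m1: "m1 (Img v) = x" "m1 (Alt v) = y" "m1 (Cur v) = m (Cur v)" "m1 (Res u) = m (Res u)"
    "m1 (Prd v) = m (Prd v)" "u \<noteq> v \<Longrightarrow> m1 (prod_encode (k, u)) = m (prod_encode (k, u))" for u k
    by (auto simp: m1_def enter_def)
  define m2 where "m2 = sem R (prelude v) m1"
  have pre: "m1 (Img v) < N" "m1 (Cur v) < N" "m1 (Res v) < B" "m1 (Prd v) < B"
    using m1 A_less[OF xA] curN resle prdle by auto
  note pc = prelude_correct[where R = R, OF pre(1,2) B2 pre(3,4), folded m2_def, unfolded m1]
  have nv: "top_vertex t \<noteq> v" if "t \<in> set ts" for t
    using dist that top_vertex_in_preorder[of t] by auto
  have m2u: "m2 (prod_encode (k, u)) = m (prod_encode (k, u))" if "u \<noteq> v" for k u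
    using pc(7)[OF that] m1(6)[OF that] by simp
  have m2a: "m2 (Img u) = (?\<phi>(v := x)) u" if "u \<in> set (v # anc)" for u
  proof (cases "u = v")
    case False
    then have "u \<notin> set (preorder (Node v ts))" using that dist by auto
    then show ?thesis using i(1) m2u[OF False] False by (simp add: agree_off_def)
  qed (use pc in simp)
  have rdt: "ready (Some v) (v # anc) t m2" if t: "t \<in> set ts" for t
  proof -
    have "?n t \<le> (\<Sum>t\<leftarrow>ts. ?n t)" using t by (simp add: member_le_sum_list)
    then have "N ^ Suc (?n t) \<le> N ^ Suc (Suc (\<Sum>t\<leftarrow>ts. ?n t))" using N by (intro power_increasing) auto
    then have 1: "N ^ Suc (?n t) < B" using big by linarith
    have 2: "distinct ((v # anc) @ preorder t)" using dist t by (auto simp: distinct_concat_iff)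
    have 3: "m2 (Res (top_vertex t)) \<le> N ^ ?n t" if "(v, top_vertex t) \<in> E"
      using m2u[OF nv[OF t]] i(5)[OF t that] child_sum_le[OF sub(2)] by simp
    have 4: "\<forall>u\<in>set (v # anc). m2 (Img u) \<in> fst ` A" using m2a img xA by simp
    show ?thesis unfolding ready_def using 1 2 3 4 pc yA by simp
  qed
  define m3 where "m3 = sem R (seqs (map (code E (Some v) (v # anc)) ts)) m2"
  have ch: "safe R B (seqs (map (code E (Some v) (v # anc)) ts)) m2
    \<and> agree_off (set (concat (map preorder ts))) m2 m3
    \<and> (\<forall>t\<in>set ts. m3 (Res (top_vertex t)) = outcome (Some v) (v # anc) t m2)"
    unfolding m3_def using IH rdt dist by (intro children_correct) auto
  have m3v: "m3 (prod_encode (k, u)) = m2 (prod_encode (k, u))" if "u \<in> set (v # anc)" for k u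
  proof -
    have "u \<notin> set (concat (map preorder ts))" using that dist by auto
    then show ?thesis using ch unfolding agree_off_def by blast
  qed
  \<comment> \<open>An adjacent child advances its sum by the new arc; any other child has just
    recomputed its full count.\<close>
  have res: "m3 (Res (top_vertex t)) = child_val ?es anc v ?\<phi> x t" if t: "t \<in> set ts" for t
  proof (cases "(v, top_vertex t) \<in> E")
    case True
    have "rooted_count E A (v # anc) t ((\<lambda>u. m2 (Img u))(top_vertex t := y))
      = rooted_count E A (v # anc) t (?\<phi>(v := x, top_vertex t := y))"
      using m2a by (intro rooted_count_cong) auto
    moreover have "m3 (Res (top_vertex t)) = m2 (Res (top_vertex t)) * m2 (Same v)
        + rooted_count E A (v # anc) t ((\<lambda>u. m2 (Img u))(top_vertex t := m2 (Alt v)))"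
      using ch t True by (simp add: outcome_def paired_def)
    ultimately show ?thesis
      using True m2u[OF nv[OF t]] i(5)[OF t True] pc(2,6) child_sum_snoc[OF es i(3)]
      by (simp add: child_val_def)
  next
    case False
    have "tree_count E A (v # anc) t (\<lambda>u. m2 (Img u)) = tree_count E A (v # anc) t (?\<phi>(v := x))"
      using m2a by (intro tree_count_cong) auto
    then show ?thesis using ch t False by (simp add: outcome_def paired_def child_val_def)
  qed
  define m4 where "m4 = sem R (combine E anc v ts) m3"
  have comb: "safe R B (combine E anc v ts) m3
    \<and> m4 (Prd v) = fits E A anc v (\<lambda>u. m3 (Img u)) * (\<Prod>t\<leftarrow>ts. m3 (Res (top_vertex t)))
    \<and> (\<forall>z. z \<noteq> Prd v \<longrightarrow> z \<noteq> Tmp v \<longrightarrow> m4 z = m3 z)"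
    unfolding m4_def
  proof (rule combine_correct[where N = N and g = ?n])
    show "\<forall>u\<in>set (v # anc). m3 (Img u) \<in> pverts (host R)"
      using m3v m2a subsetD[OF A_verts(1) img] subsetD[OF A_verts(1) xA] by simp
    show "\<forall>t\<in>set ts. top_vertex t \<noteq> v \<and> m3 (Res (top_vertex t)) \<le> N ^ ?n t"
      using nv res child_val_le[OF sub(1)] by simp
    show "N ^ Suc (\<Sum>t\<leftarrow>ts. ?n t) < B" using big p1(1) by linarith
  qed (use N in simp)
  have "fits E A anc v (\<lambda>u. m3 (Img u)) = fits E A anc v (?\<phi>(v := x))"
    using m3v m2a by (intro fits_cong) simp
  then have prd: "m4 (Prd v) = ?g ?es x"
    using comb res by (simp add: group_val_def cong: map_cong)
  have m4r: "m4 (Res v) = m2 (Res v)" "m4 (Cur v) = x" "m4 (Res (top_vertex t)) = m3 (Res (top_vertex t))" for t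
    using comb m3v pc by auto
  \<comment> \<open>What remains after the withdrawal are the contributions of the other sources,
    which the new arc does not alter.\<close>
  have m2r: "m2 (Res v) = (\<Sum>x'\<in>fst ` set es - {x}. ?g ?es x')"
  proof -
    have "(\<Sum>x'\<in>fst ` set es - {x}. ?g ?es x') = (\<Sum>x'\<in>fst ` set es - {x}. ?g es x')"
      by (intro sum.cong) (auto simp: group_val_snoc_other)
    also have "\<dots> = m (Res v) - m (Prd v) * of_bool (x = m (Cur v))"
    proof (cases "x = m (Cur v) \<and> es \<noteq> []")
      case True
      then have "x \<in> fst ` set es" using i(3) by auto
      then have "m (Res v) = ?g es x + (\<Sum>x'\<in>fst ` set es - {x}. ?g es x')"
        unfolding i(2) by (intro sum.remove) auto
      then show ?thesis using True i(4) by simp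
    next
      \<comment> \<open>This includes a first arc with source 0: \<open>Cur v\<close> agrees with
        it, but \<open>Prd v\<close> is 0, so nothing is subtracted.\<close>
      case False
      have "x \<notin> fst ` set es" by (rule fst_notin_prefix[OF es]) (use False i(3) in auto)
      then have "fst ` set es - {x} = fst ` set es" by auto
      then show ?thesis using False i(2,4) by auto
    qed
    finally show ?thesis using pc(3) by simp
  qed
  have tot: "m4 (Res v) + m4 (Prd v) = (\<Sum>x'\<in>fst ` set ?es. ?g ?es x')"
  proof -
    have "fst ` set ?es = insert x (fst ` set es - {x})" by auto
    then have "(\<Sum>x'\<in>fst ` set ?es. ?g ?es x') = ?g ?es x + (\<Sum>x'\<in>fst ` set es - {x}. ?g ?es x')"
      by (simp only:) (subst sum.insert; simp)
    then show ?thesis using m4r(1) m2r prd by simp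
  qed
  have totle: "m4 (Res v) + m4 (Prd v) < B"
    unfolding tot
    using sum_group_val_le[OF sub(1) image_mono[OF sub(1)], of anc v ts ?\<phi>] p1(1) big by linarith
  have s: "sem R body m1 = m4(Res v := m4 (Res v) + m4 (Prd v))"
    unfolding body_def sem.simps val.simps m2_def[symmetric] m3_def[symmetric] m4_def[symmetric] ..
  have f: "safe R B body m1"
    unfolding body_def safe.simps sem.simps val.simps arc_ok.simps m2_def[symmetric] m3_def[symmetric] m4_def[symmetric]
    using pc(1) ch comb totle by blast
  have ag: "agree_off (set (preorder (Node v ts))) m\<^sub>0 (m4(Res v := m4 (Res v) + m4 (Prd v)))"
    unfolding agree_off_def
  proof (intro allI impI)
    fix k u assume u: "u \<notin> set (preorder (Node v ts))"
    then have uv: "u \<noteq> v" by simp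
    have "m4 (prod_encode (k, u)) = m3 (prod_encode (k, u))" using comb uv by simp
    also have "\<dots> = m2 (prod_encode (k, u))" using ch u by (simp add: agree_off_def)
    also have "\<dots> = m (prod_encode (k, u))" by (rule m2u[OF uv])
    also have "\<dots> = m\<^sub>0 (prod_encode (k, u))" using i(1) u by (simp add: agree_off_def)
    finally show "(m4(Res v := m4 (Res v) + m4 (Prd v))) (prod_encode (k, u)) = m\<^sub>0 (prod_encode (k, u))"
      using uv by simp
  qed
  have "loop_inv m\<^sub>0 anc v ts ?es (m4(Res v := m4 (Res v) + m4 (Prd v)))"
    unfolding loop_inv_def
  proof (intro conjI ballI impI)
    show "(m4(Res v := m4 (Res v) + m4 (Prd v))) (Res (top_vertex t))
        = child_sum ?es anc v ?\<phi> ((m4(Res v := m4 (Res v) + m4 (Prd v))) (Cur v)) t"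
      if "t \<in> set ts" "(v, top_vertex t) \<in> E" for t
      using that nv m4r(2,3) res by (simp add: child_val_def)
  qed (use ag tot m4r prd in simp_all)
  then show ?thesis using xyB f s unfolding m1_def by simp
qed

lemma good_loop:
  assumes IH: "\<And>t po anc m. t \<in> set ts \<Longrightarrow> ready po anc t m \<Longrightarrow> good po anc t m"
    and rd: "ready po anc (Node v ts) m" and p: "\<not> paired E po v"
  shows "good po anc (Node v ts) m"
proof -
  let ?body = "Seq (prelude v) (Seq (seqs (map (code E (Some v) (v # anc)) ts))
         (Seq (combine E anc v ts) (Let (Res v) (Pls (Res v) (Prd v)))))"
  let ?loop = "Loop v (Img v) (Alt v) (Flag v) ?body"
  have dist: "distinct (anc @ v # concat (map preorder ts))"
    and big: "N ^ Suc (Suc (\<Sum>t\<leftarrow>ts. length (preorder t))) < B"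
    using rd unfolding ready_def length_preorder by auto
  have B: "0 < B" using big by linarith
  define m1 where "m1 = m(Res v := 0, Prd v := 0, Cur v := 0)"
  define m2 where "m2 = sem R (seqs (map (\<lambda>t. Let (Res (top_vertex t)) (Cst 0)) ts)) m1"
  have cd: "code E po anc (Node v ts) = Seq (Let (Res v) (Cst 0)) (Seq (Let (Prd v) (Cst 0)) (Seq (Let (Cur v) (Cst 0))
       (Seq (seqs (map (\<lambda>t. Let (Res (top_vertex t)) (Cst 0)) ts)) ?loop)))"
    using p by simp
  have m2: "m2 z = (if z \<in> (\<lambda>t. Res (top_vertex t)) ` set ts then 0 else m1 z)" for z
    unfolding m2_def zero_children ..
  have m2v: "m2 (Res v) = 0" "m2 (Prd v) = 0" "m2 (Cur v) = 0"
    by (auto simp: m2 m1_def)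
  have ag: "agree_off (set (preorder (Node v ts))) m m2"
    unfolding agree_off_def
  proof (intro allI impI)
    fix k u assume u: "u \<notin> set (preorder (Node v ts))"
    have "prod_encode (k, u) \<notin> (\<lambda>t. Res (top_vertex t)) ` set ts"
    proof
      assume "prod_encode (k, u) \<in> (\<lambda>t. Res (top_vertex t)) ` set ts"
      then obtain t where "t \<in> set ts" "u = top_vertex t" by auto
      then show False using u top_vertex_in_preorder[of t] by auto
    qed
    then show "m2 (prod_encode (k, u)) = m (prod_encode (k, u))" using u by (simp add: m2 m1_def)
  qed
  have "loop_inv m anc v ts [] m2"
    unfolding loop_inv_def using ag m2v by (auto simp: m2 child_sum_def)
  then have "safe R B ?loop m2
    \<and> (\<exists>m'. loop_inv m anc v ts (edge_seq R) m' \<and> sem R ?loop m2 = m'(Flag v := 0))"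
    by (rule loop_rule[where I = "loop_inv m anc v ts"]) (rule loop_step[OF IH rd], assumption+)
  then obtain m' where sf: "safe R B ?loop m2" and inv: "loop_inv m anc v ts (edge_seq R) m'"
    and s': "sem R ?loop m2 = m'(Flag v := 0)" by blast
  have s: "sem R (code E po anc (Node v ts)) m = m'(Flag v := 0)"
    unfolding cd sem.simps(2,3) val.simps m1_def[symmetric] m2_def[symmetric] s' ..
  have f: "safe R B (code E po anc (Node v ts)) m"
    unfolding cd safe.simps(2,3) sem.simps(2,3) val.simps arc_ok.simps m1_def[symmetric] m2_def[symmetric]
    using sf B zero_children(1) by simp
  have "agree_off (set (preorder (Node v ts))) m m'" using inv by (simp add: loop_inv_def)
  then have ag': "agree_off (set (preorder (Node v ts))) m (m'(Flag v := 0))"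
    unfolding agree_off_def by simp
  \<comment> \<open>Once all arcs are read, both kinds of children hold the same quantity.\<close>
  have cv: "child_val (edge_seq R) anc v \<phi> x t = tree_count E A (v # anc) t (\<phi>(v := x))" if "t \<in> set ts" for \<phi> x t
  proof (cases "(v, top_vertex t) \<in> E")
    case True
    have "top_vertex t \<noteq> v" using dist that top_vertex_in_preorder[of t] by auto
    then show ?thesis
      using True tree_count_paired[of v "v # anc" t E A "\<phi>(v := x)"] finite_A A_verts(2)
      by (simp add: child_val_def child_sum_def edges(1))
  qed (simp add: child_val_def)
  have "m' (Res v) = tree_count E A anc (Node v ts) (\<lambda>u. m (Img u))"
    using inv cv by (simp add: loop_inv_def edges(1) group_val_def cong: map_cong)
  then show ?thesis unfolding good_def s using f ag' p by (simp add: outcome_def)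
qed

lemma code_correct: "ready po anc t m \<Longrightarrow> good po anc t m"
proof (induction t arbitrary: po anc m)
  case (Node v ts)
  show ?case
  proof (cases "paired E po v")
    case True
    then show ?thesis using good_paired[OF Node.IH Node.prems] by (auto simp: paired_def)
  next
    case False
    then show ?thesis using good_loop[OF Node.IH Node.prems] by blast
  qed
qed

end

section \<open>Iterators and well-formedness of the generated program\<close>

lemma iters_seqs [simp]: "iters (seqs cs) = (\<Union>c\<in>set cs. iters c)"
  by (induction cs) auto

lemma wf_com_seqs [simp]: "wf_com (seqs cs) \<longleftrightarrow> (\<forall>c\<in>set cs. wf_com c)"
  by (induction cs) auto

lemma nest_seqs_le [simp]: "nest (seqs cs) \<le> k \<longleftrightarrow> (\<forall>c\<in>set cs. nest c \<le> k)"
  by (induction cs) auto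

lemma combine_static [simp]:
  "iters (combine E anc v ts) = {}" "wf_com (combine E anc v ts)" "nest (combine E anc v ts) \<le> k"
  by (auto simp: combine_def check_arcs_def times_children_def)

lemma prelude_static [simp]: "iters (prelude v) = {}" "wf_com (prelude v)" "nest (prelude v) \<le> k"
  by (auto simp: prelude_def)

lemma iters_code: "iters (code E po anc t) \<subseteq> set (preorder t)"
proof (induction t arbitrary: po anc)
  case (Node v ts)
  have "iters (code E po' (v # anc) t) \<subseteq> \<Union> (set ` preorder ` set ts)" if "t \<in> set ts" for po' t
    using Node.IH[OF that] that by blast
  then show ?case by auto
qed

lemma wf_com_code: "distinct (preorder t) \<Longrightarrow> wf_com (code E po anc t)"
proof (induction t arbitrary: po anc)
  case (Node v ts)
  have "wf_com (code E po' (v # anc) t)" if "t \<in> set ts" for po' t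
    using Node that by (simp add: distinct_concat_iff)
  moreover have "v \<notin> iters (code E (Some v) (v # anc) t)" if "t \<in> set ts" for t
    using iters_code Node.prems that by fastforce
  ultimately show ?case by auto
qed

section \<open>Number of nested passes\<close>

text \<open>Mirrors \<open>code\<close>: after a paired vertex the next one on the path starts a
  pass even if the two are adjacent.\<close>

fun passes :: "('a \<times> 'a) set \<Rightarrow> 'a list \<Rightarrow> nat" where
  "passes E [] = 0"
| "passes E [v] = 1"
| "passes E (u # v # p) = Suc (if (u, v) \<in> E then passes E p else passes E (v # p))"

lemma root_leaf_path_Cons: "p \<in> root_leaf_paths t \<Longrightarrow> \<exists>p'. p = top_vertex t # p'"
  by (cases t) (auto split: if_splits)

lemma root_leaf_paths_nonempty: "root_leaf_paths t \<noteq> {}"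
  by (induction t) (auto simp: neq_Nil_conv)

lemma root_leaf_path_child:
  "t \<in> set ts \<Longrightarrow> p \<in> root_leaf_paths t \<Longrightarrow> v # p \<in> root_leaf_paths (Node v ts)"
  by (cases ts) auto

text \<open>One part for each branch of \<open>code\<close>. In the second, the pass of the parent
  \<open>u\<close> is counted by \<open>passes\<close> but lies outside the code for
  \<open>t\<close>, whence \<open>Suc K\<close>.\<close>

lemma nest_code_le:
  "(\<not> paired E po (top_vertex t) \<longrightarrow> (\<forall>p\<in>root_leaf_paths t. passes E p \<le> K) \<longrightarrow> nest (code E po anc t) \<le> K)
   \<and> (\<forall>u. po = Some u \<longrightarrow> (u, top_vertex t) \<in> E \<longrightarrow>
        (\<forall>p\<in>root_leaf_paths t. passes E (u # p) \<le> Suc K) \<longrightarrow> nest (code E po anc t) \<le> K)"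
proof (induction t arbitrary: po anc K)
  case (Node v ts)
  show ?case
  proof (intro conjI impI allI)
    assume np: "\<not> paired E po (top_vertex (Node v ts))"
      and le: "\<forall>p\<in>root_leaf_paths (Node v ts). passes E p \<le> K"
    \<comment> \<open>Each path needs a pass, so one can be set aside for the loop of
      \<open>v\<close> itself.\<close>
    have "K \<noteq> 0"
    proof -
      obtain p where p: "p \<in> root_leaf_paths (Node v ts)" using root_leaf_paths_nonempty by blast
      obtain p' where "p = v # p'" using root_leaf_path_Cons[OF p] by auto
      then have "0 < passes E p" by (cases p') auto
      then show ?thesis using le p by fastforce
    qed
    then obtain K' where K: "K = Suc K'" by (cases K) auto
    have "nest (code E (Some v) (v # anc) t) \<le> K'" if t: "t \<in> set ts" for t
    proof -
      have ps: "passes E (v # p) \<le> Suc K'" if "p \<in> root_leaf_paths t" for p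
        using le root_leaf_path_child[OF t that] unfolding K by blast
      show ?thesis
      proof (cases "(v, top_vertex t) \<in> E")
        case True
        then show ?thesis using Node.IH[OF t, of "Some v" K' "v # anc"] ps by blast
      next
        case False
        have "passes E p \<le> K'" if "p \<in> root_leaf_paths t" for p
          using ps[OF that] root_leaf_path_Cons[OF that] False by auto
        then show ?thesis using Node.IH[OF t, of "Some v" K' "v # anc"] False by (auto simp: paired_def)
      qed
    qed
    then show "nest (code E po anc (Node v ts)) \<le> K" using np K by auto
  next
    fix u assume u: "po = Some u" "(u, top_vertex (Node v ts)) \<in> E"
      and le: "\<forall>p\<in>root_leaf_paths (Node v ts). passes E (u # p) \<le> Suc K"
    have "nest (code E None (v # anc) t) \<le> K" if t: "t \<in> set ts" for t
    proof -
      have "passes E p \<le> K" if "p \<in> root_leaf_paths t" for p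
        using bspec[OF le root_leaf_path_child[OF t that]] u by simp
      then show ?thesis using Node.IH[OF t, of None K "v # anc"] by (auto simp: paired_def)
    qed
    then show "nest (code E po anc (Node v ts)) \<le> K" using u by (auto simp: paired_def)
  qed
qed

text \<open>A surplus vertex in front costs only one block more: either it is joined to the first
  vertex of a pair, whose second vertex becomes the surplus one, or it stays single and the pairs
  are met in step.\<close>

lemma passes_even_blocks:
  assumes "\<forall>b\<in>set bs. length b = 2 \<and> (b ! 0, b ! 1) \<in> E"
  shows "passes E (concat bs) \<le> length bs \<and> (\<forall>a. passes E (a # concat bs) \<le> Suc (length bs))"
  using assms
proof (induction bs)
  case (Cons b bs)
  obtain x y where "b = [x, y]" "(x, y) \<in> E"
    using Cons.prems by (auto simp: length_Suc_conv eval_nat_numeral)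
  then show ?case using Cons by auto
qed auto

text \<open>The greedy choice follows the pairs up to the block of size 3, takes its first edge and
  leaves its third vertex as the surplus vertex of \<open>passes_even_blocks\<close>.\<close>

lemma passes_odd_blocks:
  assumes "\<forall>b\<in>set bs. length b = 2 \<or> length b = 3"
    and "length (filter (\<lambda>b. length b = 3) bs) = 1"
    and "\<forall>b\<in>set bs. \<forall>i. Suc i < length b \<longrightarrow> (b ! i, b ! Suc i) \<in> E"
  shows "passes E (concat bs) \<le> Suc (length bs) \<and> length (concat bs) = Suc (2 * length bs)"
  using assms
proof (induction bs)
  case (Cons b bs)
  have edge: "(b ! 0, b ! 1) \<in> E" using Cons.prems(1,3) by auto
  show ?case
  proof (cases "length b = 2")
    case True
    then obtain x y where "b = [x, y]" by (auto simp: length_Suc_conv eval_nat_numeral)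
    then show ?thesis using Cons edge True by auto
  next
    case False
    then have "length b = 3" using Cons.prems(1) by simp
    then obtain x y z where b: "b = [x, y, z]" by (auto simp: length_Suc_conv eval_nat_numeral)
    have "filter (\<lambda>b. length b = 3) bs = []" using Cons.prems(2) b by simp
    then have two: "\<forall>b\<in>set bs. length b = 2" using Cons.prems(1) by (auto simp: filter_empty_conv)
    then have "\<forall>b\<in>set bs. length b = 2 \<and> (b ! 0, b ! 1) \<in> E" using Cons.prems(3) by auto
    from passes_even_blocks[OF this] have "passes E (concat (b # bs)) \<le> Suc (length (b # bs))"
      using b edge by simp
    moreover have "length (concat bs) = 2 * length bs" using two by (induction bs) auto
    ultimately show ?thesis using b by simp
  qed
qed simp

lemma passes_matching:
  "even (length p) \<Longrightarrow> \<forall>i. even i \<and> Suc i < length p \<longrightarrow> (p ! i, p ! Suc i) \<in> E \<Longrightarrow> passes E p \<le> length p div 2"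
proof (induction p rule: passes.induct[of _ E])
  case (3 E u v p)
  have "(u, v) \<in> E" using 3(4)[rule_format, of 0] by simp
  moreover have "passes E p \<le> length p div 2"
  proof (rule 3(1)[OF \<open>(u, v) \<in> E\<close>])
    show "\<forall>i. even i \<and> Suc i < length p \<longrightarrow> (p ! i, p ! Suc i) \<in> E"
    proof (intro allI impI)
      fix i assume "even i \<and> Suc i < length p"
      then show "(p ! i, p ! Suc i) \<in> E" using 3(4)[rule_format, of "Suc (Suc i)"] by simp
    qed
  qed (use 3 in auto)
  ultimately show ?case by simp
qed auto

lemma passes_matched_path:
  assumes "matched_path G p"
  shows "passes (parcs G) p \<le> (length p + 1) div 2"
proof (cases "even (length p)")
  case True
  then show ?thesis using assms passes_matching[OF True] by (simp add: matched_path_def)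
next
  case False
  then obtain bs where "concat bs = p" "\<forall>b\<in>set bs. length b = 2 \<or> length b = 3"
     "length (filter (\<lambda>b. length b = 3) bs) = 1"
     "\<forall>b\<in>set bs. \<forall>i. Suc i < length b \<longrightarrow> (b ! i, b ! Suc i) \<in> parcs G"
    using assms by (auto simp: matched_path_def)
  then show ?thesis using passes_odd_blocks[of bs "parcs G"] by auto
qed

section \<open>Homomorphisms and elimination trees\<close>

text \<open>The set that \<open>tree_count\<close> counts: homomorphisms on \<open>S\<close>
  compatible with an assignment of the ancestors.\<close>

definition exts :: "('a \<times> 'a) set \<Rightarrow> ('b \<times> 'b) set \<Rightarrow> 'a list \<Rightarrow> 'a set \<Rightarrow> ('a \<Rightarrow> 'b) \<Rightarrow> ('a \<Rightarrow> 'b) set" where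
  "exts E A anc S \<phi> = {\<psi> \<in> S \<rightarrow>\<^sub>E fst ` A. (\<forall>u\<in>S. \<forall>v\<in>S. (u, v) \<in> E \<longrightarrow> (\<psi> u, \<psi> v) \<in> A)
     \<and> (\<forall>u\<in>set anc. \<forall>v\<in>S. (u, v) \<in> E \<longrightarrow> (\<phi> u, \<psi> v) \<in> A)}"

lemma finite_exts: "finite A \<Longrightarrow> finite S \<Longrightarrow> finite (exts E A anc S \<phi>)"
  unfolding exts_def by (rule finite_subset[of _ "S \<rightarrow>\<^sub>E fst ` A"]) (auto intro: finite_PiE)

text \<open>With no edge between \<open>S\<close> and \<open>T\<close>, the two restrictions can be
  chosen independently.\<close>

lemma card_exts_Un:
  assumes "S \<inter> T = {}" "\<And>u v. u \<in> S \<Longrightarrow> v \<in> T \<Longrightarrow> (u, v) \<notin> E" "sym E"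
  shows "card (exts E A anc (S \<union> T) \<phi>) = card (exts E A anc S \<phi>) * card (exts E A anc T \<phi>)"
proof -
  let ?f = "\<lambda>\<psi>. (restrict \<psi> S, restrict \<psi> T)" and ?g = "\<lambda>(a, b) x. if x \<in> S then a x else b x"
  have noE: "(v, u) \<notin> E" "(u, v) \<notin> E" if "u \<in> S" "v \<in> T" for u v
    using assms(2)[OF that] assms(3) by (auto dest: symD)
  have "bij_betw ?f (exts E A anc (S \<union> T) \<phi>) (exts E A anc S \<phi> \<times> exts E A anc T \<phi>)"
  proof (rule bij_betw_byWitness[where f' = ?g])
    show "\<forall>\<psi>\<in>exts E A anc (S \<union> T) \<phi>. ?g (?f \<psi>) = \<psi>"
      by (auto simp: exts_def fun_eq_iff PiE_def extensional_def)
    show "\<forall>ab\<in>exts E A anc S \<phi> \<times> exts E A anc T \<phi>. ?f (?g ab) = ab"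
      using assms(1) by (auto simp: exts_def fun_eq_iff PiE_def extensional_def restrict_def)
    show "?f ` exts E A anc (S \<union> T) \<phi> \<subseteq> exts E A anc S \<phi> \<times> exts E A anc T \<phi>"
      by (auto simp: exts_def PiE_def Pi_def)
    show "?g ` (exts E A anc S \<phi> \<times> exts E A anc T \<phi>) \<subseteq> exts E A anc (S \<union> T) \<phi>"
    proof clarify
      fix a b assume a: "a \<in> exts E A anc S \<phi>" and b: "b \<in> exts E A anc T \<phi>"
      let ?h = "\<lambda>x. if x \<in> S then a x else b x"
      have hS: "?h x = a x" if "x \<in> S" for x using that by simp
      have hT: "?h x = b x" if "x \<in> T" for x using that assms(1) by auto
      have "?h \<in> S \<union> T \<rightarrow>\<^sub>E fst ` A"
        using a b by (auto simp: exts_def PiE_def Pi_def extensional_def)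
      moreover have "(?h u, ?h v) \<in> A" if "u \<in> S \<union> T" "v \<in> S \<union> T" "(u, v) \<in> E" for u v
      proof -
        from that noE consider "u \<in> S" "v \<in> S" | "u \<in> T" "v \<in> T" by blast
        then show ?thesis
        proof cases
          case 1
          then show ?thesis using a that(3) by (simp add: exts_def)
        next
          case 2
          then show ?thesis using b that(3) hT by (simp only: exts_def mem_Collect_eq)
        qed
      qed
      moreover have "(\<phi> u, ?h v) \<in> A" if "u \<in> set anc" "v \<in> S \<union> T" "(u, v) \<in> E" for u v
        using a b that by (auto simp: exts_def)
      ultimately show "?h \<in> exts E A anc (S \<union> T) \<phi>" unfolding exts_def by blast
    qed
  qed
  from bij_betw_same_card[OF this] show ?thesis by (simp add: card_cartesian_product)
qed

text \<open>Classifies the extensions by the image of \<open>v\<close>, which thereby becomes an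
  ancestor of the remaining vertices.\<close>

lemma card_exts_insert:
  assumes "v \<notin> S" "v \<notin> set anc" "sym E" "sym A" "irrefl E" "finite A" "finite S"
  shows "card (exts E A anc (insert v S) \<phi>)
    = (\<Sum>x\<in>fst ` A. fits E A anc v (\<phi>(v := x)) * card (exts E A (v # anc) S (\<phi>(v := x))))"
proof -
  let ?X = "{x \<in> fst ` A. fits E A anc v (\<phi>(v := x)) = 1}"
  let ?D = "SIGMA x:?X. exts E A (v # anc) S (\<phi>(v := x))"
  let ?f = "\<lambda>\<psi>. (\<psi> v, \<psi>(v := undefined))" and ?g = "\<lambda>(x, \<psi>). \<psi>(v := x)"
  have ck: "fits E A anc v (\<phi>(v := x)) = 1 \<longleftrightarrow> (\<forall>u\<in>set anc. (u, v) \<in> E \<longrightarrow> (\<phi> u, x) \<in> A)" for x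
    using assms(2) by (auto simp: fits_def)
  have vv: "(v, v) \<notin> E" using assms(5) by (auto simp: irrefl_def)
  have nS: "u \<noteq> v" if "u \<in> S" for u using that assms(1) by auto
  have nA: "u \<noteq> v" if "u \<in> set anc" for u using that assms(2) by auto
  have "bij_betw ?f (exts E A anc (insert v S) \<phi>) ?D"
  proof (rule bij_betw_byWitness[where f' = ?g])
    show "\<forall>\<psi>\<in>exts E A anc (insert v S) \<phi>. ?g (?f \<psi>) = \<psi>" by auto
    show "\<forall>x\<psi>\<in>?D. ?f (?g x\<psi>) = x\<psi>"
      using assms(1) by (auto simp: exts_def fun_eq_iff PiE_def extensional_def)
    show "?f ` exts E A anc (insert v S) \<phi> \<subseteq> ?D"
    proof (rule image_subsetI)
      fix \<psi> assume p: "\<psi> \<in> exts E A anc (insert v S) \<phi>"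
      have 1: "\<psi> v \<in> ?X" using p unfolding ck mem_Collect_eq by (auto simp: exts_def)
      have 2: "\<psi>(v := undefined) \<in> S \<rightarrow>\<^sub>E fst ` A"
        using p assms(1) by (auto simp: exts_def PiE_def Pi_def extensional_def)
      have "\<psi>(v := undefined) \<in> exts E A (v # anc) S (\<phi>(v := \<psi> v))"
        unfolding exts_def mem_Collect_eq
        using 2 p nS nA by (auto simp: exts_def)
      then show "?f \<psi> \<in> ?D" using 1 by blast
    qed
    show "?g ` ?D \<subseteq> exts E A anc (insert v S) \<phi>"
    proof clarify
      fix x y \<psi> assume xy: "(x, y) \<in> A" and c: "fits E A anc v (\<phi>(v := fst (x, y))) = 1"
        and p: "\<psi> \<in> exts E A (v # anc) S (\<phi>(v := fst (x, y)))"
      have c': "(\<phi> u, x) \<in> A" if "u \<in> set anc" "(u, v) \<in> E" for u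
        using c that unfolding ck by simp
      have "x \<in> fst ` A" using xy by force
      then have 1: "\<psi>(v := x) \<in> insert v S \<rightarrow>\<^sub>E fst ` A"
        using p by (auto simp: exts_def PiE_def Pi_def extensional_def)
      have e: "(x, \<psi> w) \<in> A" if "w \<in> S" "(v, w) \<in> E" for w
        using p that by (auto simp: exts_def)
      \<comment> \<open>Ancestors constrain only outgoing arcs; the reverse ones follow from the
        symmetry of both relations.\<close>
      have e': "(\<psi> w, x) \<in> A" if "w \<in> S" "(w, v) \<in> E" for w
        using e[OF that(1)] that assms(3,4) by (auto dest: symD)
      have s: "(\<psi> u, \<psi> w) \<in> A" if "u \<in> S" "w \<in> S" "(u, w) \<in> E" for u w
        using p that by (auto simp: exts_def)
      have a: "(\<phi> u, \<psi> w) \<in> A" if "u \<in> set anc" "w \<in> S" "(u, w) \<in> E" for u w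
        using p that nA by (auto simp: exts_def)
      show "\<psi>(v := fst (x, y)) \<in> exts E A anc (insert v S) \<phi>"
        unfolding exts_def mem_Collect_eq using 1 vv nS nA e e' s a c' by auto
    qed
  qed
  then have "card (exts E A anc (insert v S) \<phi>) = card ?D" by (rule bij_betw_same_card)
  also have "\<dots> = (\<Sum>x\<in>?X. card (exts E A (v # anc) S (\<phi>(v := x))))"
    using assms(6,7) by (subst card_SigmaI) (auto intro: finite_exts)
  also have "\<dots> = (\<Sum>x\<in>fst ` A. fits E A anc v (\<phi>(v := x)) * card (exts E A (v # anc) S (\<phi>(v := x))))"
    using assms(6) by (intro sum.mono_neutral_cong_left) (auto simp: fits_def)
  finally show ?thesis .
qed

text \<open>All that the counting needs from the components. Pairs are constrained in list order
  only; \<open>sym E\<close> supplies the other direction.\<close>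

fun separated :: "('a \<times> 'a) set \<Rightarrow> 'a rtree \<Rightarrow> bool" where
  "separated E (Node v ts) \<longleftrightarrow> (\<forall>t\<in>set ts. separated E t)
     \<and> sorted_wrt (\<lambda>t t'. \<forall>u\<in>set (preorder t). \<forall>v\<in>set (preorder t'). (u, v) \<notin> E) ts"

lemma card_exts_concat:
  assumes "distinct (concat (map preorder ts))" "sym E"
    and "sorted_wrt (\<lambda>t t'. \<forall>u\<in>set (preorder t). \<forall>v\<in>set (preorder t'). (u, v) \<notin> E) ts"
  shows "card (exts E A anc (set (concat (map preorder ts))) \<phi>)
    = (\<Prod>t\<leftarrow>ts. card (exts E A anc (set (preorder t)) \<phi>))"
  using assms
proof (induction ts)
  case Nil
  have "exts E A anc {} \<phi> = {\<lambda>_. undefined}" by (auto simp: exts_def)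
  then show ?case by simp
next
  case (Cons t ts)
  have "card (exts E A anc (set (preorder t) \<union> set (concat (map preorder ts))) \<phi>)
    = card (exts E A anc (set (preorder t)) \<phi>) * card (exts E A anc (set (concat (map preorder ts))) \<phi>)"
    using Cons.prems by (intro card_exts_Un) auto
  moreover have "set (concat (map preorder (t # ts))) = set (preorder t) \<union> set (concat (map preorder ts))"
    by simp
  ultimately show ?case using Cons by (simp only: list.map prod_list.Cons) simp
qed

lemma card_exts_tree:
  assumes "sym E" "sym A" "irrefl E" "finite A"
    and "separated E t" "distinct (anc @ preorder t)"
  shows "card (exts E A anc (set (preorder t)) \<phi>) = tree_count E A anc t \<phi>"
  using assms(5,6)
proof (induction t arbitrary: anc \<phi>)
  case (Node v ts)
  have d: "distinct (concat (map preorder ts))" using Node.prems by simp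
  have "card (exts E A (v # anc) (set (preorder t)) \<psi>) = tree_count E A (v # anc) t \<psi>" if "t \<in> set ts" for t \<psi>
    using Node.prems that by (intro Node.IH) (auto simp: distinct_concat_iff)
  then have "card (exts E A (v # anc) (set (concat (map preorder ts))) \<psi>) = (\<Prod>t\<leftarrow>ts. tree_count E A (v # anc) t \<psi>)" for \<psi>
    using card_exts_concat[OF d assms(1), of A "v # anc" \<psi>] Node.prems(1) by (simp cong: map_cong)
  moreover have "card (exts E A anc (insert v (set (concat (map preorder ts)))) \<phi>)
    = (\<Sum>x\<in>fst ` A. fits E A anc v (\<phi>(v := x)) * card (exts E A (v # anc) (set (concat (map preorder ts))) (\<phi>(v := x))))"
    using Node.prems(2) assms(1-4) by (intro card_exts_insert) auto
  ultimately show ?case by (simp only: preorder.simps list.set tree_count.simps)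
qed

section \<open>Components and elimination trees\<close>

lemma pair_graph_induced:
  assumes "pair_graph G" "S \<subseteq> pverts G"
  shows "pair_graph (induced G S)"
proof -
  interpret pair_graph G by fact
  have "finite S" using finite_subset[OF assms(2)] by simp
  show ?thesis
  proof
    show "symmetric (with_proj (induced G S))"
      using arcs_symmetric by (auto simp: symmetric_def sym_def induced_def)
  qed (use \<open>finite S\<close> assms(2) pair_no_loops in \<open>auto simp: induced_def\<close>)
qed

text \<open>In a symmetric graph reachability is an equivalence, so distinct components are disjoint
  and have no arcs between them.\<close>

lemma components_props:
  assumes "pair_graph G"
  shows "\<And>C. C \<in> components G \<Longrightarrow> pair_graph C"
    and "\<And>C. C \<in> components G \<Longrightarrow> parcs G \<inter> pverts C \<times> pverts C \<subseteq> parcs C"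
    and "\<And>C C' u v. C \<in> components G \<Longrightarrow> C' \<in> components G \<Longrightarrow> C \<noteq> C' \<Longrightarrow>
      u \<in> pverts C \<Longrightarrow> v \<in> pverts C' \<Longrightarrow> u \<noteq> v \<and> (u, v) \<notin> parcs G"
    and "\<Union> (pverts ` components G) = pverts G"
proof -
  interpret pair_graph G by fact
  let ?K = "\<lambda>u. {v. u \<rightarrow>\<^sup>*\<^bsub>with_proj G\<^esub> v}"
  have K: "?K u \<subseteq> pverts G" for u using reachable_in_verts(2) by auto
  have sym: "v \<rightarrow>\<^sup>*\<^bsub>with_proj G\<^esub> u" if "u \<rightarrow>\<^sup>*\<^bsub>with_proj G\<^esub> v" for u v
    using symmetric_reachable' that by blast
  have cl: "?K u = ?K v" if "v \<in> ?K u" for u v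
    using that sym reachable_trans by blast
  show "pair_graph C" if "C \<in> components G" for C
    using that pair_graph_induced[OF assms K] by (auto simp: components_def)
  show "parcs G \<inter> pverts C \<times> pverts C \<subseteq> parcs C" if "C \<in> components G" for C
    using that by (auto simp: components_def induced_def)
  show "u \<noteq> v \<and> (u, v) \<notin> parcs G"
    if C: "C \<in> components G" "C' \<in> components G" "C \<noteq> C'" and uv: "u \<in> pverts C" "v \<in> pverts C'" for C C' u v
  proof -
    obtain a b where ab: "C = induced G (?K a)" "C' = induced G (?K b)"
      using C by (auto simp: components_def)
    have Ku: "?K a = ?K u" "?K b = ?K v" using cl uv ab by (auto simp: induced_def)
    have "v \<notin> ?K u" using cl[of v u] Ku ab C(3) by auto
    moreover have "u \<in> pverts G" using uv(1) ab K by (auto simp: induced_def)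
    ultimately show ?thesis by auto
  qed
  show "\<Union> (pverts ` components G) = pverts G"
  proof
    show "\<Union> (pverts ` components G) \<subseteq> pverts G" using subsetD[OF K] by (auto simp: components_def induced_def)
    show "pverts G \<subseteq> \<Union> (pverts ` components G)"
    proof
      fix u assume u: "u \<in> pverts G"
      then have "induced G (?K u) \<in> components G" by (auto simp: components_def)
      moreover have "u \<in> pverts (induced G (?K u))" using u by (simp add: induced_def)
      ultimately show "u \<in> \<Union> (pverts ` components G)" by blast
    qed
  qed
qed

text \<open>Lifts separation from a component to the whole graph, which has no further arcs among
  the vertices of that component.\<close>

lemma separated_mono:
  "separated E t \<Longrightarrow> E' \<inter> set (preorder t) \<times> set (preorder t) \<subseteq> E \<Longrightarrow> separated E' t"
proof (induction t)
  case (Node v ts)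
  have "separated E' t" if "t \<in> set ts" for t
    using Node that by (intro Node.IH) auto
  moreover have "sorted_wrt (\<lambda>t t'. \<forall>u\<in>set (preorder t). \<forall>v\<in>set (preorder t'). (u, v) \<notin> E') ts"
    using Node.prems(1) unfolding separated.simps
    by (elim conjE sorted_wrt_mono_rel[rotated]) (use Node.prems(2) in fastforce)
  ultimately show ?case by simp
qed

lemma elim_tree_props:
  assumes "elim_tree G t" "pair_graph G"
  shows "set (preorder t) = pverts G \<and> distinct (preorder t) \<and> separated (parcs G) t"
  using assms
proof (induction rule: elim_tree.induct)
  case (1 r G Cs ts)
  let ?G = "remove_vertex G r"
  have pg: "pair_graph ?G" unfolding remove_vertex_def using 1(5) by (intro pair_graph_induced) auto
  note cp = components_props[OF pg]
  have arcs: "parcs ?G = parcs G \<inter> (pverts G - {r}) \<times> (pverts G - {r})" "pverts ?G = pverts G - {r}"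
    by (auto simp: remove_vertex_def induced_def)
  have sub: "C \<in> set Cs \<Longrightarrow> C \<in> components ?G" for C using 1(3) by simp
  have "list_all2 (\<lambda>C t. C \<in> components ?G \<and> set (preorder t) = pverts C \<and> distinct (preorder t)
      \<and> separated (parcs C) t) Cs ts"
    using 1(4) sub cp(1) by (auto simp: list_all2_conv_all_nth)
  moreover note 1(2)
  \<comment> \<open>The last conjunct ties each tree to a component, so that a new head can be
    separated from all trees behind it.\<close>
  ultimately have "set (concat (map preorder ts)) = \<Union> (pverts ` set Cs) \<and> distinct (concat (map preorder ts))
    \<and> (\<forall>t\<in>set ts. separated (parcs G) t)
    \<and> sorted_wrt (\<lambda>t t'. \<forall>u\<in>set (preorder t). \<forall>v\<in>set (preorder t'). (u, v) \<notin> parcs G) ts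
    \<and> (\<forall>t\<in>set ts. \<exists>C\<in>set Cs. set (preorder t) = pverts C)"
  proof (induction rule: list_all2_induct)
    case (Cons C Cs t ts)
    have V: "pverts C \<subseteq> pverts G - {r}" using Cons.hyps(1) cp(4) arcs(2) by blast
    have sep: "separated (parcs G) t"
    proof (rule separated_mono)
      show "parcs G \<inter> set (preorder t) \<times> set (preorder t) \<subseteq> parcs C"
        using cp(2)[of C] Cons.hyps(1) V arcs(1) by auto
    qed (use Cons in simp)
    have disj: "u \<noteq> v \<and> (u, v) \<notin> parcs G" if "C' \<in> set Cs" "u \<in> pverts C" "v \<in> pverts C'" for C' u v
    proof -
      have C': "C' \<in> components ?G" using Cons.hyps(2) that(1) by (auto simp: list_all2_conv_all_nth in_set_conv_nth)
      moreover have "C \<noteq> C'" using Cons.prems that(1) by auto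
      ultimately have "u \<noteq> v \<and> (u, v) \<notin> parcs ?G" using cp(3) Cons.hyps(1) that by blast
      moreover have "v \<in> pverts G - {r}" "u \<in> pverts G - {r}" using C' cp(4) that V arcs(2) by blast+
      ultimately show ?thesis using arcs(1) by auto
    qed
    have IH: "set (concat (map preorder ts)) = \<Union> (pverts ` set Cs)" "distinct (concat (map preorder ts))"
      "\<forall>t\<in>set ts. separated (parcs G) t"
      "sorted_wrt (\<lambda>t t'. \<forall>u\<in>set (preorder t). \<forall>v\<in>set (preorder t'). (u, v) \<notin> parcs G) ts"
      "\<forall>t\<in>set ts. \<exists>C\<in>set Cs. set (preorder t) = pverts C"
      using Cons.IH Cons.prems by auto
    have "set (preorder t) \<inter> set (concat (map preorder ts)) = {}"
      using disj Cons.hyps(1) unfolding IH(1) by blast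
    moreover have "\<forall>t'\<in>set ts. \<forall>u\<in>set (preorder t). \<forall>v\<in>set (preorder t'). (u, v) \<notin> parcs G"
      using disj Cons.hyps(1) IH(5) by metis
    ultimately show ?case using IH sep Cons.hyps(1) by auto
  qed auto
  then have *: "set (concat (map preorder ts)) = pverts G - {r}" "distinct (concat (map preorder ts))"
    "separated (parcs G) (Node r ts)"
    using cp(4) arcs(2) 1(3) by auto
  have "set (preorder (Node r ts)) = insert r (set (concat (map preorder ts)))" by simp
  moreover have "distinct (preorder (Node r ts)) \<longleftrightarrow> r \<notin> set (concat (map preorder ts)) \<and> distinct (concat (map preorder ts))"
    by simp
  ultimately show ?case using * 1(1) by (simp only: insert_Diff) simp
qed

section \<open>Renaming the pattern vertices by natural numbers\<close>

lemma preorder_map_rtree: "preorder (map_rtree f t) = map f (preorder t)"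
  by (induction t) (simp add: map_concat o_def cong: map_cong)

lemma root_leaf_paths_map_rtree: "root_leaf_paths (map_rtree f t) = map f ` root_leaf_paths t"
proof (induction t)
  case (Node v ts)
  then have "(\<Union>t\<in>set ts. root_leaf_paths (map_rtree f t)) = map f ` (\<Union>t\<in>set ts. root_leaf_paths t)"
    by (simp add: image_UN)
  then show ?case by (auto simp: image_image)
qed

lemma root_leaf_path_subset: "p \<in> root_leaf_paths t \<Longrightarrow> set p \<subseteq> set (preorder t)"
proof (induction t arbitrary: p)
  case (Node v ts)
  show ?case
  proof (cases "ts = []")
    case False
    then obtain t q where "t \<in> set ts" "q \<in> root_leaf_paths t" "p = v # q" using Node.prems by auto
    then show ?thesis using Node.IH by fastforce
  qed (use Node.prems in simp)
qed

text \<open>Memory cells and iterators are indexed by pattern vertices, which must therefore be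
  natural numbers.\<close>

definition map_arcs :: "('a \<Rightarrow> 'b) \<Rightarrow> ('a \<times> 'a) set \<Rightarrow> ('b \<times> 'b) set" where
  "map_arcs f E = (\<lambda>(u, v). (f u, f v)) ` E"

lemma map_arcs_iff:
  assumes "inj_on f V" "E \<subseteq> V \<times> V" "u \<in> V" "v \<in> V"
  shows "(f u, f v) \<in> map_arcs f E \<longleftrightarrow> (u, v) \<in> E"
proof
  assume "(f u, f v) \<in> map_arcs f E"
  then obtain u' v' where e: "(u', v') \<in> E" "f u' = f u" "f v' = f v" by (auto simp: map_arcs_def)
  then have "u' \<in> V" "v' \<in> V" using assms(2) by auto
  then have "u' = u" "v' = v" using e(2,3) assms(1,3,4) by (blast dest: inj_onD)+
  then show "(u, v) \<in> E" using e(1) by simp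
qed (force simp: map_arcs_def)

lemma passes_map:
  assumes "inj_on f V" "E \<subseteq> V \<times> V"
  shows "set p \<subseteq> V \<Longrightarrow> passes (map_arcs f E) (map f p) = passes E p"
  by (induction p rule: induct_list012) (auto simp: map_arcs_iff[OF assms])

lemma tree_count_map:
  assumes "inj_on f V" "E \<subseteq> V \<times> V"
  shows "set anc \<subseteq> V \<Longrightarrow> set (preorder t) \<subseteq> V \<Longrightarrow>
    tree_count (map_arcs f E) A (map f anc) (map_rtree f t) \<phi> = tree_count E A anc t (\<phi> \<circ> f)"
proof (induction t arbitrary: anc \<phi>)
  case (Node v ts)
  have v: "v \<in> V" using Node.prems by simp
  \<comment> \<open>Injectivity is known only on \<open>V\<close>, so the functions agree only
    there; the congruence lemmas bridge the gap.\<close>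
  have eq: "((\<phi>(f v := x)) \<circ> f) u = ((\<phi> \<circ> f)(v := x)) u" if "u \<in> set (v # anc)" for u x
    using that Node.prems(1) v assms(1) by (auto dest: inj_onD)
  have "fits (map_arcs f E) A (map f anc) (f v) (\<phi>(f v := x)) = fits E A anc v ((\<phi>(f v := x)) \<circ> f)" for x
  proof -
    have "(f u, f v) \<in> map_arcs f E \<longleftrightarrow> (u, v) \<in> E" if "u \<in> set anc" for u
      using that v Node.prems(1) by (intro map_arcs_iff[OF assms]) auto
    then show ?thesis by (simp add: fits_def)
  qed
  also have "fits E A anc v ((\<phi>(f v := x)) \<circ> f) = fits E A anc v ((\<phi> \<circ> f)(v := x))" for x
    using eq by (intro fits_cong) auto
  finally have c: "fits (map_arcs f E) A (map f anc) (f v) (\<phi>(f v := x)) = fits E A anc v ((\<phi> \<circ> f)(v := x))" for x .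
  have "tree_count (map_arcs f E) A (f v # map f anc) (map_rtree f t) (\<phi>(f v := x)) = tree_count E A (v # anc) t ((\<phi> \<circ> f)(v := x))"
    if "t \<in> set ts" for t x
  proof -
    have "tree_count (map_arcs f E) A (map f (v # anc)) (map_rtree f t) (\<phi>(f v := x)) = tree_count E A (v # anc) t ((\<phi>(f v := x)) \<circ> f)"
      using Node.prems that by (intro Node.IH) auto
    also have "\<dots> = tree_count E A (v # anc) t ((\<phi> \<circ> f)(v := x))" using eq by (intro tree_count_cong) auto
    finally show ?thesis by simp
  qed
  then show ?case using c by (simp add: o_def cong: map_cong)
qed

text \<open>A homomorphism maps a vertex with a neighbour to a vertex with a neighbour, so
  restricting images to sources of arcs loses nothing.\<close>

lemma homs_eq_exts:
  assumes "pair_graph G" "pair_graph H" "\<And>u. u \<in> pverts G \<Longrightarrow> \<exists>v. (u, v) \<in> parcs G"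
  shows "homs G H = exts (parcs G) (parcs H) [] (pverts G) \<phi>"
proof -
  interpret G: pair_graph G by fact
  interpret H: pair_graph H by fact
  have "fst ` parcs H \<subseteq> pverts H" by (auto dest: H.in_arcsD1)
  moreover have "\<psi> u \<in> fst ` parcs H"
    if "\<forall>u v. (u, v) \<in> parcs G \<longrightarrow> (\<psi> u, \<psi> v) \<in> parcs H" "u \<in> pverts G" for \<psi> u
    using assms(3)[OF that(2)] that(1) by force
  moreover have "u \<in> pverts G \<and> v \<in> pverts G" if "(u, v) \<in> parcs G" for u v
    using that G.in_arcsD1 G.in_arcsD2 by blast
  ultimately show ?thesis
    unfolding homs_def exts_def PiE_def Pi_def by (intro Collect_cong) (auto; blast)
qed

text \<open>The first arc of a path to \<open>w\<close> in the symmetric closure leaves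
  \<open>u\<close> in one orientation, hence in both.\<close>

lemma connected_has_neighbour:
  assumes "pair_graph G" "Digraph_Component.connected (with_proj G)" "u \<in> pverts G" "w \<in> pverts G" "u \<noteq> w"
  shows "\<exists>v. (u, v) \<in> parcs G"
proof -
  interpret pair_graph G by fact
  have "u \<rightarrow>\<^sup>*\<^bsub>with_proj (mk_symmetric (with_proj G))\<^esub> w"
    using assms(2-4) by (auto simp: Digraph_Component.connected_def strongly_connected_def mk_symmetric_def)
  then have "(u, w) \<in> (arcs_ends (with_proj (mk_symmetric (with_proj G))))\<^sup>*"
    by (auto simp: reachable_def dest: rtrancl_on_rtranclI)
  then obtain v where "(u, v) \<in> arcs_ends (with_proj (mk_symmetric (with_proj G)))"
    using assms(5) by (meson converse_rtranclE)
  then have "(u, v) \<in> parcs G \<or> (v, u) \<in> parcs G" by (auto simp: mk_symmetric_def)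
  then show ?thesis using arcs_symmetric by blast
qed

section \<open>Assembly of the program\<close>

lemma code_computes:
  fixes t :: "nat rtree" and E :: "(nat \<times> nat) set"
  assumes rep: "valid_rep c\<^sub>0 k\<^sub>0 w R" and dist: "distinct (preorder t)"
  defines "c \<equiv> Seq (code E None [] t) (Let 0 (Var (Res (top_vertex t))))"
    and "b \<equiv> length (preorder t) + 2"
  shows "safe R (2 ^ (b * w)) c (\<lambda>_. 0)" "sem R c (\<lambda>_. 0) 0 = tree_count E (parcs (host R)) [] t (\<lambda>_. 0)"
proof -
  have w: "0 < w" using rep by (simp add: valid_rep_def)
  have "(2 :: nat) ^ 1 \<le> 2 ^ w" using w by (intro power_increasing) auto
  then interpret host_env R "2 ^ w" "2 ^ (b * w)" E
    using rep by (intro host_env.intro) (auto simp: valid_rep_def)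
  \<comment> \<open>One word per pattern vertex, one for the spare factor in \<open>ready\<close>,
    and one to make the inequality strict.\<close>
  have "w * Suc (length (preorder t)) < b * w" using w by (simp add: b_def)
  then have "(2 ^ w :: nat) ^ Suc (length (preorder t)) < 2 ^ (b * w)"
    unfolding power_mult[symmetric] by (intro power_strict_increasing) auto
  then have "ready None [] t (\<lambda>_. 0)" using dist by (simp add: ready_def)
  then have good: "good None [] t (\<lambda>_. 0)" by (rule code_correct)
  then have res: "sem R (code E None [] t) (\<lambda>_. 0) (Res (top_vertex t)) = tree_count E (parcs (host R)) [] t (\<lambda>_. 0)"
    by (simp add: good_def outcome_def paired_def)
  then show "sem R c (\<lambda>_. 0) 0 = tree_count E (parcs (host R)) [] t (\<lambda>_. 0)" by (simp add: c_def)
  have "sem R (code E None [] t) (\<lambda>_. 0) (Res (top_vertex t)) < 2 ^ (b * w)"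
  proof (rule safe_bounded)
    show one: "1 < (2 :: nat) ^ (b * w)" using w by (intro one_less_power) (auto simp: b_def)
    then show "0 < (2 :: nat) ^ (b * w)" by simp
  qed (use good in \<open>simp add: good_def\<close>)
  then show "safe R (2 ^ (b * w)) c (\<lambda>_. 0)" using good by (simp add: c_def good_def)
qed

lemma mtd_attained:
  assumes "mtd G = enat d"
  obtains t where "matched_elim_tree G t" "depth t = d"
proof -
  let ?S = "{enat (depth t) | t. matched_elim_tree G t}"
  have "?S \<noteq> {}"
  proof
    assume "?S = {}"
    then have "mtd G = \<infinity>" unfolding mtd_def by (simp add: Inf_enat_def)
    then show False using assms by simp
  qed
  then have "Inf ?S \<in> ?S" unfolding Inf_enat_def by (metis (no_types, lifting) LeastI equals0I)
  then show ?thesis using assms that unfolding mtd_def by auto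
qed

lemma finite_root_leaf_paths: "finite (root_leaf_paths t)"
  by (induction t) auto

text \<open>Excludes the one-vertex pattern, whose homomorphisms into isolated host vertices no pass
  would meet: its single path is odd and too short for a block of size 3.\<close>

lemma matched_elim_tree_two_vertices:
  assumes "matched_elim_tree G t" "set (preorder t) = V" "distinct (preorder t)" "u \<in> V"
  shows "\<exists>w\<in>V. w \<noteq> u"
proof (rule ccontr)
  assume "\<not> ?thesis"
  then have V: "V = {u}" using assms(4) by blast
  obtain v ts where t: "t = Node v ts" by (cases t)
  have ts: "ts = []"
  proof (rule ccontr)
    assume "ts \<noteq> []"
    then obtain t' where t': "t' \<in> set ts" by (cases ts) auto
    have "top_vertex t' \<in> V" "v \<in> V" using assms(2) t t' top_vertex_in_preorder[of t'] by auto
    then have "top_vertex t' = v" using V by simp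
    then show False using assms(3) t t' top_vertex_in_preorder[of t'] by auto
  qed
  then have "matched_path G [v]" using assms(1) t by (simp add: matched_elim_tree_def)
  then obtain bs where bs: "concat bs = [v]" "length (filter (\<lambda>b. length b = 3) bs) = 1"
    by (auto simp: matched_path_def)
  from bs(2) obtain b where "b \<in> set bs" "length b = 3"
    by (metis (mono_tags, lifting) filter_False list.size(3) zero_neq_one)
  then have "length b \<le> length (concat bs)" by (induction bs) auto
  then show False using bs(1) \<open>length b = 3\<close> by simp
qed

theorem theorem1:
  fixes G :: "'a pair_pre_digraph" and d :: nat
  assumes "pair_graph G" and "Digraph_Component.connected (with_proj G)" and "mtd G = enat d"
  shows "\<exists>(P :: instr list) (S :: nat) (b :: nat).
           \<forall>(c\<^sub>0 :: real) (k\<^sub>0 :: nat). \<exists>(c :: real) (k :: nat).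
             \<forall>(R :: host_rep) (w :: nat). valid_rep c\<^sub>0 k\<^sub>0 w R \<longrightarrow>
               computes_within P R w (card (homs G (host R)))
                 (soft_bound c k (nat \<lceil>real d / 2\<rceil>) (host R)) S b"
proof -
  interpret G: pair_graph G by fact
  obtain t where mt: "matched_elim_tree G t" and dt: "depth t = d" using mtd_attained[OF assms(3)] .
  have et: "elim_tree G t" and mp: "\<And>p. p \<in> root_leaf_paths t \<Longrightarrow> matched_path G p"
    using mt by (auto simp: matched_elim_tree_def)
  have V: "set (preorder t) = pverts G" and dist: "distinct (preorder t)" and sep: "separated (parcs G) t"
    using elim_tree_props[OF et assms(1)] by auto
  have nb: "\<exists>v. (u, v) \<in> parcs G" if u: "u \<in> pverts G" for u
    using matched_elim_tree_two_vertices[OF mt V dist u] connected_has_neighbour[OF assms(1,2) u] by metis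
  obtain f :: "'a \<Rightarrow> nat" where f: "inj_on f (pverts G)"
    using finite_imp_inj_to_nat_seg[OF G.pair_finite_verts] by blast
  have sub: "parcs G \<subseteq> pverts G \<times> pverts G" by (auto dest: G.in_arcsD1 G.in_arcsD2)
  define E where "E = map_arcs f (parcs G)"
  define t' where "t' = map_rtree f t"
  define prog where "prog = Seq (code E None [] t') (Let 0 (Var (Res (top_vertex t'))))"
  define b where "b = length (preorder t') + 2"
  have dist': "distinct (preorder t')"
    using dist f V by (simp add: t'_def preorder_map_rtree distinct_map)
  have e: "nat \<lceil>real d / 2\<rceil> = (d + 1) div 2"
  proof (cases "even d")
    case False
    then obtain n where "d = 2 * n + 1" by (elim oddE)
    then have "real d / 2 = real n + 1 / 2" by simp
    then have "\<lceil>real d / 2\<rceil> = int n + 1" by (simp add: ceiling_unique)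
    then show ?thesis using \<open>d = 2 * n + 1\<close> by simp
  qed (auto elim!: evenE)
  have "passes E p \<le> (d + 1) div 2" if p: "p \<in> root_leaf_paths t'" for p
  proof -
    obtain q where q: "q \<in> root_leaf_paths t" "p = map f q"
      using p by (auto simp: t'_def root_leaf_paths_map_rtree)
    have "passes E p = passes (parcs G) q"
      unfolding E_def q(2) using root_leaf_path_subset[OF q(1)] V by (intro passes_map[OF f sub]) simp
    also have "\<dots> \<le> (length q + 1) div 2" by (rule passes_matched_path[OF mp[OF q(1)]])
    also have "\<dots> \<le> (d + 1) div 2"
      using q(1) finite_root_leaf_paths[of t] unfolding dt[symmetric] depth_def
      by (intro div_le_mono add_right_mono Max_ge) auto
    finally show ?thesis .
  qed
  then have nest: "nest prog \<le> nat \<lceil>real d / 2\<rceil>"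
    unfolding e prog_def using nest_code_le[of E None t' "(d + 1) div 2" "[]"] by (simp add: paired_def)
  have wf: "wf_com prog" using wf_com_code[OF dist'] by (simp add: prog_def)
  \<comment> \<open>The assignment read off the zero memory is arbitrary: without ancestors it
    constrains nothing.\<close>
  have count: "tree_count E (parcs (host R)) [] t' (\<lambda>_. 0) = card (homs G (host R))"
    if rep: "valid_rep c\<^sub>0 k\<^sub>0 w R" for c\<^sub>0 k\<^sub>0 w R
  proof -
    have H: "pair_graph (host R)" using rep by (simp add: valid_rep_def)
    interpret H: pair_graph "host R" by fact
    have "tree_count E (parcs (host R)) [] t' (\<lambda>_. 0) = tree_count (parcs G) (parcs (host R)) [] t ((\<lambda>_. 0) \<circ> f)"
      using tree_count_map[OF f sub, of "[]" t "parcs (host R)" "\<lambda>_. 0"] V by (simp add: E_def t'_def)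
    also have "\<dots> = card (exts (parcs G) (parcs (host R)) [] (set (preorder t)) ((\<lambda>_. 0) \<circ> f))"
      using sep dist H.pair_finite_arcs
      by (intro card_exts_tree[symmetric])
        (auto simp: sym_def irrefl_def G.arcs_symmetric H.arcs_symmetric dest: G.pair_no_loops)
    also have "\<dots> = card (homs G (host R))"
      unfolding V using homs_eq_exts[OF assms(1) H nb] by metis
    finally show ?thesis .
  qed
  \<comment> \<open>Program, space and word bound depend on the pattern alone. The constant of the
    representation enters only through \<open>time_const\<close>, and its logarithmic exponent is
    inherited unchanged.\<close>
  have "computes_within (compile 0 prog) R w (card (homs G (host R)))
      (soft_bound (time_const c\<^sub>0 prog) k\<^sub>0 (nat \<lceil>real d / 2\<rceil>) (host R)) (program_space (compile 0 prog)) b"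
    if rep: "valid_rep c\<^sub>0 k\<^sub>0 w R" for c\<^sub>0 k\<^sub>0 w R
    using code_computes[OF rep dist', of E] count[OF rep]
    by (intro computes_within_compile[OF rep _ wf _ _ nest]) (simp_all add: prog_def b_def)
  then show ?thesis by blast
qed

end
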